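(* Let $a>0$ and $w>0$. If $f\in C^{n}[0,a]$ and $n\ge2$, then the new Levin approximation $Q^{[0,a],L}_{\log,w,n}[f]$ of $\int_0^a f(x)\log(x)e^{iwx}\,dx$ based on arbitrary points $0\le\hat x_0<\hat x_1<\dots<\hat x_{n-1}\le a$ (as defined in the context) has absolute error $$E_n(f):=\left|\int_0^a f(x)\log(x)e^{iwx}\,dx-Q^{[0,a],L}_{\log,w,n}[f]\right|$$ satisfying $$E_n(f)\le C\,(1+|\ln(w)|)\,w^{-1}\,\frac{\|f^{(n)}\|_\infty\,a^n}{(n-1)!}.$$ Moreover, when $\hat x_0=0$, $\hat x_{n-1}=a$ and $n\ge3$ (i.e. both endpoints are included), $$E_n(f)\le C\,(1+|\ln(w)|)\,w^{-2}\,\frac{\|f^{(n)}\|_\infty\,a^{n-1}}{(n-2)!}.$$ Here $C$ denotes a constant independent of $n$ and $w$ (possibly different in the two inequalities).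
   Context: $\|\cdot\|_\infty$ is the maximum norm on $[0,a]$. New Levin method (linear oscillator $g(x)=x$) based on points $\hat x_0,\dots,\hat x_{n-1}$, all linear systems being solved exactly: (1) $\hat q_1$ is the polynomial of degree at most $n-1$ with $\hat q_1'(\hat x_j)+iw\,\hat q_1(\hat x_j)=f(\hat x_j)$ for $j=0,\dots,n-1$. (2) $\hat q_2(x):=\frac{\hat q_1(x)-\hat q_1(0)}{x}$ for $x\ne0$ and $\hat q_2(0):=\hat q_1'(0)$; this is a polynomial. (3) $\hat h_1$ is the polynomial of degree at most $n-1$ with $\hat h_1'(\hat x_j)+iw\,\hat h_1(\hat x_j)=-\hat q_2(\hat x_j)$ for $j=0,\dots,n-1$. (4) $\hat h_2(x):=\hat q_1(0)e^{-iwx}\left(\gamma+\Gamma(0,-iwx)+\operatorname{Log}(-iwx)\right)$ for $x\neq0$ and $\hat h_2(0):=0$, where $\gamma$ is Euler's constant, $\operatorname{Log}(z)=\log|z|+i\arg(z)$ is the principal logarithm, and $\Gamma(0,z)=\int_z^\infty e^{-t}t^{-1}\,dt$ is the complementary incomplete Gamma function (principal branch), with $\Gamma(0,z)=-\gamma-\operatorname{Log}(z)-\sum_{j\ge1}\frac{(-z)^j}{j\,(j!)}$. (5) With $\hat q(x):=\hat q_1(x)-\hat q_1(0)e^{-iwx}$ (so $\hat q(0)=0$ and $\hat q(x)\log x\to0$ as $x\to0^+$), $$Q^{[0,a],L}_{\log,w,n}[f]:=\Big[\hat q(x)e^{iwx}\log x+\hat h_1(x)e^{iwx}+\hat h_2(x)e^{iwx}\Big]_{x=0}^{x=a}=e^{iwa}\big(\hat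 q_1(a)\log a+\hat h_1(a)+\hat h_2(a)\big)-\big(\hat q_1(0)\log a+\hat h_1(0)\big),$$ where the value at $x=0$ of the first term is understood as its limit $0$. *)

theory Defs
  imports "HOL-Analysis.Analysis" "HOL-Computational_Algebra.Polynomial"
begin

definition iter_deriv_on :: "real set \<Rightarrow> nat \<Rightarrow> (real \<Rightarrow> complex) \<Rightarrow> real \<Rightarrow> complex" where
  "iter_deriv_on S k f = ((\<lambda>g x. vector_derivative g (at x within S)) ^^ k) f"

text \<open>On a compact interval, derivatives at the end points are one-sided.\<close>
definition Ck_on :: "nat \<Rightarrow> real set \<Rightarrow> (real \<Rightarrow> complex) \<Rightarrow> bool" where
  "Ck_on n S f \<longleftrightarrow> (\<forall>k<n. iter_deriv_on S k f differentiable_on S) \<and>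
     continuous_on S (iter_deriv_on S n f)"

text \<open>The maximum norm; it is only used for functions that are continuous on the compact
  interval \<open>[0,a]\<close>, so that the supremum is a maximum.\<close>
definition max_norm :: "real \<Rightarrow> (real \<Rightarrow> complex) \<Rightarrow> real" where
  "max_norm a g = (SUP x\<in>{0..a}. norm (g x))"

definition levin_interpolates ::
    "real \<Rightarrow> nat \<Rightarrow> (nat \<Rightarrow> real) \<Rightarrow> (real \<Rightarrow> complex) \<Rightarrow> complex poly \<Rightarrow> bool" where
  "levin_interpolates w n xs g p \<longleftrightarrow> degree p \<le> n - 1 \<and>
     (\<forall>j<n. poly (pderiv p) (of_real (xs j)) + \<i> * of_real w * poly p (of_real (xs j)) = g (xs j))"

text \<open>For \<open>w > 0\<close> and distinct points \<open>xs 0, \<dots>, xs (n - 1)\<close> with \<open>n \<ge> 1\<close>, there is exactly one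
  such polynomial; see \<open>levin_interpolates_unique\<close> below.\<close>
definition levin_poly ::
    "real \<Rightarrow> nat \<Rightarrow> (nat \<Rightarrow> real) \<Rightarrow> (real \<Rightarrow> complex) \<Rightarrow> complex poly" where
  "levin_poly w n xs g = (THE p. levin_interpolates w n xs g p)"

definition levin_q1 ::
    "real \<Rightarrow> nat \<Rightarrow> (nat \<Rightarrow> real) \<Rightarrow> (real \<Rightarrow> complex) \<Rightarrow> complex poly" where
  "levin_q1 w n xs f = levin_poly w n xs f"

definition levin_q2 ::
    "real \<Rightarrow> nat \<Rightarrow> (nat \<Rightarrow> real) \<Rightarrow> (real \<Rightarrow> complex) \<Rightarrow> real \<Rightarrow> complex" where
  "levin_q2 w n xs f x =
     (if x = 0 then poly (pderiv (levin_q1 w n xs f)) 0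
      else (poly (levin_q1 w n xs f) (of_real x) - poly (levin_q1 w n xs f) 0) / of_real x)"

definition levin_h1 ::
    "real \<Rightarrow> nat \<Rightarrow> (nat \<Rightarrow> real) \<Rightarrow> (real \<Rightarrow> complex) \<Rightarrow> complex poly" where
  "levin_h1 w n xs f = levin_poly w n xs (\<lambda>x. - levin_q2 w n xs f x)"

text \<open>The principal branch of \<open>\<Gamma>(0,z) = \<integral>\<^sub>z\<^sup>\<infinity> e\<^sup>-\<^sup>t / t dt\<close>. The path of integration is the horizontal
  ray \<open>t = z + s\<close>, \<open>s \<ge> 0\<close>, which avoids the branch cut exactly if \<open>z\<close> is not in \<open>(-\<infinity>,0]\<close>; the
  value at points of the cut is irrelevant here.\<close>
definition Gamma0 :: "complex \<Rightarrow> complex" where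
  "Gamma0 z = integral {0..} (\<lambda>s::real. exp (- (z + of_real s)) / (z + of_real s))"

definition levin_h2 ::
    "real \<Rightarrow> nat \<Rightarrow> (nat \<Rightarrow> real) \<Rightarrow> (real \<Rightarrow> complex) \<Rightarrow> real \<Rightarrow> complex" where
  "levin_h2 w n xs f x =
     (if x = 0 then 0
      else poly (levin_q1 w n xs f) 0 * exp (- \<i> * of_real w * of_real x) *
        (euler_mascheroni + Gamma0 (- \<i> * of_real w * of_real x)
          + Ln (- \<i> * of_real w * of_real x)))"

definition levin_q ::
    "real \<Rightarrow> nat \<Rightarrow> (nat \<Rightarrow> real) \<Rightarrow> (real \<Rightarrow> complex) \<Rightarrow> real \<Rightarrow> complex" where
  "levin_q w n xs f x = poly (levin_q1 w n xs f) (of_real x)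
     - poly (levin_q1 w n xs f) 0 * exp (- \<i> * of_real w * of_real x)"

text \<open>At \<open>x = 0\<close> the first summand is \<open>0\<close> (as \<open>levin_q w n xs f 0 = 0\<close>), which is also its limit
  for \<open>x \<rightarrow> 0+\<close>.\<close>
definition levin_antideriv ::
    "real \<Rightarrow> nat \<Rightarrow> (nat \<Rightarrow> real) \<Rightarrow> (real \<Rightarrow> complex) \<Rightarrow> real \<Rightarrow> complex" where
  "levin_antideriv w n xs f x =
     levin_q w n xs f x * exp (\<i> * of_real w * of_real x) * of_real (ln x)
     + poly (levin_h1 w n xs f) (of_real x) * exp (\<i> * of_real w * of_real x)
     + levin_h2 w n xs f x * exp (\<i> * of_real w * of_real x)"

definition levin_Q ::
    "real \<Rightarrow> real \<Rightarrow> nat \<Rightarrow> (nat \<Rightarrow> real) \<Rightarrow> (real \<Rightarrow> complex) \<Rightarrow> complex" where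
  "levin_Q a w n xs f = levin_antideriv w n xs f a - levin_antideriv w n xs f 0"

definition levin_error ::
    "real \<Rightarrow> real \<Rightarrow> nat \<Rightarrow> (nat \<Rightarrow> real) \<Rightarrow> (real \<Rightarrow> complex) \<Rightarrow> real" where
  "levin_error a w n xs f =
     norm (integral {0..a} (\<lambda>x. f x * of_real (ln x) * exp (\<i> * of_real w * of_real x))
           - levin_Q a w n xs f)"

definition levin_points :: "real \<Rightarrow> nat \<Rightarrow> (nat \<Rightarrow> real) \<Rightarrow> bool" where
  "levin_points a n xs \<longleftrightarrow> strict_mono_on {..<n} xs \<and> xs ` {..<n} \<subseteq> {0..a}"

lemma levin_Q_explicit:
  "levin_Q a w n xs f =
     exp (\<i> * of_real w * of_real a) *
       (poly (levin_q1 w n xs f) (of_real a) * of_real (ln a)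
        + poly (levin_h1 w n xs f) (of_real a) + levin_h2 w n xs f a)
     - (poly (levin_q1 w n xs f) 0 * of_real (ln a) + poly (levin_h1 w n xs f) 0)"
proof -
  have e: "exp (- (\<i> * of_real w * of_real a)) * exp (\<i> * of_real w * of_real a) = (1::complex)"
    by (metis exp_minus_inverse mult.commute)
  have "exp (- (\<i> * of_real w * of_real a)) * (exp (\<i> * of_real w * of_real a) * z) = z" for z :: complex
    using e by (metis mult.assoc mult_1)
  then show ?thesis
    by (simp add: levin_Q_def levin_antideriv_def levin_q_def levin_h2_def algebra_simps)
qed

lemma levin_operator_surj:
  fixes c :: complex and u :: "complex poly"
  assumes "c \<noteq> 0"
  shows "\<exists>p. degree p \<le> degree u \<and> pderiv p + smult c p = u"
proof (induction "degree u" arbitrary: u rule: less_induct)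
  case less
  show ?case
  proof (cases "degree u = 0")
    case True
    then show ?thesis
      using assms by (intro exI[of _ "smult (1 / c) u"]) (simp add: pderiv_smult pderiv_eq_0_iff)
  next
    case False
    then have "degree (pderiv u) < degree u"
      by (simp add: degree_pderiv)
    with less[OF this] obtain v where v: "degree v \<le> degree (pderiv u)"
        "pderiv v + smult c v = pderiv u" by blast
    have "pderiv (smult (1 / c) (u - v)) + smult c (smult (1 / c) (u - v))
        = smult (1 / c) (pderiv u - pderiv v) + (u - v)"
      using assms by (simp add: pderiv_smult pderiv_diff)
    also have "pderiv u - pderiv v = smult c v"
      using v(2) by (metis add_diff_cancel_left')
    finally have "pderiv (smult (1 / c) (u - v)) + smult c (smult (1 / c) (u - v)) = u"
      using assms by simp
    moreover have "degree (smult (1 / c) (u - v)) \<le> degree u"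
      using v(1) \<open>degree (pderiv u) < degree u\<close> assms by (auto intro!: degree_diff_le)
    ultimately show ?thesis by blast
  qed
qed

lemma interpolation_exists:
  fixes xs g :: "nat \<Rightarrow> complex"
  assumes "inj_on xs {..<n}"
  shows "\<exists>p. degree p \<le> n - 1 \<and> (\<forall>j<n. poly p (xs j) = g j)"
  using assms
proof (induction n)
  case 0
  then show ?case by (intro exI[of _ 0]) auto
next
  case (Suc n)
  then obtain p where p: "degree p \<le> n - 1" "\<forall>j<n. poly p (xs j) = g j"
    by (metis inj_on_subset lessThan_subset_iff le_Suc_eq le_refl)
  define r where "r = (\<Prod>j<n. [:- xs j, 1:])"
  have r: "poly r x = (\<Prod>j<n. x - xs j)" for x
    by (simp add: r_def poly_prod)
  have dr: "degree r \<le> n"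
    unfolding r_def by (rule order_trans[OF degree_prod_sum_le]) (auto simp: sum_constant)
  have "poly r (xs n) \<noteq> 0"
    using Suc.prems by (auto simp: r dest!: inj_onD)
  moreover have "poly r (xs j) = 0" if "j < n" for j
    using that by (auto simp: r)
  ultimately show ?case
    using p dr
    by (intro exI[of _ "p + smult ((g n - poly p (xs n)) / poly r (xs n)) r"])
       (auto simp: less_Suc_eq intro!: degree_add_le)
qed

lemma levin_interpolates_unique:
  assumes "w > 0" "n \<ge> 1" "levin_points a n xs"
  shows "\<exists>!p. levin_interpolates w n xs g p"
proof -
  define c where "c = \<i> * complex_of_real w"
  have c: "c \<noteq> 0" using assms by (simp add: c_def)
  have inj: "inj_on (\<lambda>j. complex_of_real (xs j)) {..<n}"
    using assms(3) strict_mono_on_imp_inj_on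
    by (auto simp: levin_points_def inj_on_def)
  have L: "levin_interpolates w n xs g p \<longleftrightarrow> degree p \<le> n - 1 \<and>
      (\<forall>j<n. poly (pderiv p + smult c p) (of_real (xs j)) = g (xs j))" for p
    by (simp add: levin_interpolates_def c_def)
  show ?thesis
  proof (rule ex_ex1I)
    obtain u where u: "degree u \<le> n - 1" "\<forall>j<n. poly u (of_real (xs j)) = g (xs j)"
      using interpolation_exists[OF inj, of "\<lambda>j. g (xs j)"] by blast
    obtain p where "degree p \<le> degree u" "pderiv p + smult c p = u"
      using levin_operator_surj[OF c] by blast
    with u show "\<exists>p. levin_interpolates w n xs g p"
      unfolding L by (intro exI[of _ p]) auto
  next
    fix p1 p2
    assume *: "levin_interpolates w n xs g p1" "levin_interpolates w n xs g p2"
    define d where "d = p1 - p2"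
    define u where "u = pderiv d + smult c d"
    have dd: "degree d \<le> n - 1"
      using * unfolding d_def L by (intro degree_diff_le) auto
    have "degree u \<le> n - 1"
      unfolding u_def using dd by (intro degree_add_le) (auto simp: degree_pderiv)
    have u_eq: "u = (pderiv p1 + smult c p1) - (pderiv p2 + smult c p2)"
      by (simp add: u_def d_def pderiv_diff smult_diff_right)
    have roots: "poly u (of_real (xs j)) = 0" if "j < n" for j
      using * that unfolding L u_eq poly_diff by auto
    have "u = 0"
    proof (rule ccontr)
      assume "u \<noteq> 0"
      have "card ((\<lambda>j. complex_of_real (xs j)) ` {..<n}) \<le> card {x. poly u x = 0}"
        using roots poly_roots_finite[OF \<open>u \<noteq> 0\<close>] by (intro card_mono) auto
      also have "\<dots> \<le> degree u"
        using \<open>u \<noteq> 0\<close> by (rule card_poly_roots_bound)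
      finally show False
        using \<open>degree u \<le> n - 1\<close> assms(2) by (simp add: card_image[OF inj])
    qed
    have "d = 0"
    proof (rule ccontr)
      assume "d \<noteq> 0"
      have "coeff u (degree d) = c * lead_coeff d"
        by (simp add: u_def coeff_pderiv coeff_eq_0)
      with \<open>u = 0\<close> c \<open>d \<noteq> 0\<close> show False by simp
    qed
    then show "p1 = p2" by (simp add: d_def)
  qed
qed

end

theory Submission
  imports Defs "HOL-Real_Asymp.Real_Asymp"
begin

text \<open>
  Let \<open>u = q\<^sub>1' + \<i>w q\<^sub>1\<close>, the polynomial of degree at most \<open>n - 1\<close> that interpolates \<open>f\<close>. The second
  collocation problem has the polynomial right-hand side \<open>-q\<^sub>2\<close> of degree at most \<open>n - 2\<close> and is
  therefore solved exactly, so that the method returns exactly \<open>\<integral> u(x) ln x exp (\<i>wx) dx\<close>, and the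
  error is the integral of \<open>r(x) ln x exp (\<i>wx)\<close> with \<open>r = f - u\<close>.
  With \<open>E(s) = \<Gamma>(0,-\<i>s)\<close>, so that \<open>E'(s) = - exp (\<i>s) / s\<close> and \<open>\<bar>E(s)\<bar> \<le> 1 / s\<close>, the kernel has the
  antiderivative \<open>K\<^sub>1(x) = (exp (\<i>wx) ln x + E(wx)) / (\<i>w) = O((1 + \<bar>ln w\<bar>) / w)\<close>, which in turn has
  the antiderivative \<open>K\<^sub>2(x) = (K\<^sub>1(x) + x E(wx) + exp (\<i>wx) / (\<i>w)) / (\<i>w) = O((1 + \<bar>ln w\<bar>) / w\<^sup>2)\<close>.
  One integration by parts gives the first bound. If \<open>r\<close> vanishes at both end points, no boundary
  terms arise and a second integration by parts gives the second bound. The derivatives of \<open>r\<close> are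
  estimated by Rolle's theorem, applied to \<open>Re (\<theta> r)\<close> for a suitable unimodular \<open>\<theta>\<close>.
\<close>

section \<open>The entire exponential integral\<close>

definition Ein_coeff :: "nat \<Rightarrow> complex" where
  "Ein_coeff j = (if j = 0 then 0 else - ((- 1) ^ j / (of_nat j * fact j)))"

text \<open>The complementary exponential integral, that is, the integral of
  \<open>(1 - exp (- t)) / t\<close> from \<open>0\<close> to \<open>z\<close>. It is the entire
  part of \<Gamma>(0,z), left after \<open>- euler_mascheroni - Ln z\<close> has been split
  off.\<close>

definition Ein :: "complex \<Rightarrow> complex" where
  "Ein z = (\<Sum>j. Ein_coeff j * z ^ j)"

definition Ein' :: "complex \<Rightarrow> complex" where
  "Ein' z = (\<Sum>j. diffs Ein_coeff j * z ^ j)"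

lemma summable_Ein: "summable (\<lambda>j. Ein_coeff j * z ^ j)"
proof (rule summable_comparison_test'[of "\<lambda>j. inverse (fact j) * norm z ^ j" 0])
  show "summable (\<lambda>j. inverse (fact j) * norm z ^ j)"
    using summable_exp[of "norm z"] by simp
  fix j :: nat
  have "1 \<le> real j * fact j \<and> fact j \<le> real j * fact j" if "j \<noteq> 0"
    using that by (simp add: mult_ge1_I)
  then have "norm (Ein_coeff j) \<le> inverse (fact j)"
    by (cases "j = 0") (auto simp: Ein_coeff_def norm_divide norm_mult norm_power inverse_eq_divide
        intro!: divide_left_mono)
  then show "norm (Ein_coeff j * z ^ j) \<le> inverse (fact j) * norm z ^ j"
    by (simp add: norm_mult norm_power mult_right_mono)
qed

lemma Ein_has_field_derivative: "(Ein has_field_derivative Ein' z) (at z within S)"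
  unfolding Ein_def Ein'_def
  by (rule has_field_derivative_at_within, rule termdiffs_strong_converges_everywhere, rule summable_Ein)

lemma Ein_0 [simp]: "Ein 0 = 0"
  by (simp add: Ein_def Ein_coeff_def powser_zero)

text \<open>Differentiation cancels the factor \<open>j\<close> in the denominators of the series,
  and multiplication by \<open>z\<close> leaves the exponential series without its constant term.
  The product form avoids a case distinction at \<open>z = 0\<close>.\<close>

lemma mult_Ein': "z * Ein' z = 1 - exp (- z)"
proof -
  have "(\<lambda>n. (- z) ^ Suc n /\<^sub>R fact (Suc n)) sums (exp (- z) - 1)"
    using exp_converges[of "- z"] by (subst sums_Suc_iff) simp
  from sums_minus[OF this] have "(\<lambda>n. - ((- z) ^ Suc n /\<^sub>R fact (Suc n))) sums (1 - exp (- z))"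
    by simp
  moreover have "- ((- z) ^ Suc n /\<^sub>R fact (Suc n)) = z * (diffs Ein_coeff n * z ^ n)" for n
  proof -
    have "of_nat (Suc n) * Ein_coeff (Suc n) = - ((- 1) ^ Suc n / fact (Suc n))"
      unfolding Ein_coeff_def by (simp del: of_nat_Suc fact_Suc power_Suc)
    then have "z * (diffs Ein_coeff n * z ^ n) = - ((- 1) ^ Suc n / fact (Suc n)) * z ^ Suc n"
      unfolding diffs_def by (simp only: power_Suc mult_ac)
    also have "\<dots> = - ((- 1) ^ Suc n * z ^ Suc n / fact (Suc n))"
      by (simp del: fact_Suc power_Suc)
    also have "(- 1) ^ Suc n * z ^ Suc n = (- z) ^ Suc n"
      by (metis mult_minus1 power_mult_distrib)
    finally show ?thesis
      by (simp add: scaleR_conv_of_real divide_inverse mult.commute del: fact_Suc power_Suc)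
  qed
  moreover have "summable (\<lambda>n. diffs Ein_coeff n * z ^ n)"
    by (rule termdiff_converges_all) (rule summable_Ein)
  ultimately show ?thesis
    unfolding Ein'_def by (subst suminf_mult[symmetric]) (auto simp: sums_iff)
qed

lemma continuous_on_Ein' [continuous_intros]:
  assumes "continuous_on S f" shows "continuous_on S (\<lambda>x. Ein' (f x))"
proof (rule continuous_on_compose2[OF _ assms, of UNIV])
  have "summable (\<lambda>n. diffs Ein_coeff n * z ^ n)" for z
    by (rule termdiff_converges_all) (rule summable_Ein)
  then show "continuous_on UNIV Ein'"
    unfolding Ein'_def continuous_on_eq_continuous_at[OF open_UNIV]
    by (auto intro!: DERIV_isCont[OF termdiffs_strong_converges_everywhere])
qed auto

lemma continuous_on_Ein [continuous_intros]:
  assumes "continuous_on S f" shows "continuous_on S (\<lambda>x. Ein (f x))"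
  by (rule continuous_on_compose2[OF _ assms, of UNIV])
     (auto intro!: DERIV_continuous_on Ein_has_field_derivative)

section \<open>Euler's constant as the limit of \<open>Ein n - ln n\<close>\<close>

text \<open>Squeezes the integrand of \<open>H\<^sub>n\<close> against that of \<open>Ein\<close>.\<close>
lemma exp_minus_power_bounds:
  fixes s :: real
  assumes "0 \<le> s" "s \<le> real n" "n > 0"
  shows "(1 - s / n) ^ n \<le> exp (- s)" "exp (- s) - (1 - s / n) ^ n \<le> s\<^sup>2 * exp (- s) / n"
proof -
  show "(1 - s / n) ^ n \<le> exp (- s)"
    using exp_ge_one_minus_x_over_n_power_n[of s n] assms by simp
  \<comment> \<open>For the lower bound on \<open>(1 - s / n) ^ n\<close>, the factor
    \<open>exp (- s) * (1 + s / n) ^ n\<close>, which is at most \<open>1\<close>, is inserted;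
    Bernoulli's inequality then handles the power of \<open>1 - (s / n)\<^sup>2\<close>.\<close>
  have "(1 + s / n) ^ n \<le> exp s"
    using exp_ge_one_plus_x_over_n_power_n[of n s] assms by simp
  then have "exp (- s) * (1 + s / n) ^ n * (1 - s / n) ^ n \<le> 1 * (1 - s / n) ^ n"
    using assms by (intro mult_right_mono) (auto simp: exp_minus field_simps)
  then have A: "exp (- s) * ((1 + s / n) * (1 - s / n)) ^ n \<le> (1 - s / n) ^ n"
    by (simp add: power_mult_distrib mult_ac)
  have "(1 + s / n) * (1 - s / n) = 1 + - (s / n)\<^sup>2"
    by (simp add: algebra_simps power2_eq_square)
  moreover have "(s / n)\<^sup>2 \<le> 1"
    using assms by (intro power_le_one) auto
  ultimately have "1 + real n * - (s / n)\<^sup>2 \<le> ((1 + s / n) * (1 - s / n)) ^ n"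
    using Bernoulli_inequality[of "- (s / n)\<^sup>2" n] by simp
  then have "exp (- s) * (1 - s\<^sup>2 / n) \<le> exp (- s) * ((1 + s / n) * (1 - s / n)) ^ n"
    using assms by (intro mult_left_mono) (auto simp: power2_eq_square field_simps)
  with A have "exp (- s) * (1 - s\<^sup>2 / n) \<le> (1 - s / n) ^ n"
    by linarith
  then show "exp (- s) - (1 - s / n) ^ n \<le> s\<^sup>2 * exp (- s) / n"
    by (simp add: algebra_simps)
qed

text \<open>\<open>harm n\<close> is the integral of \<open>(1 - (1 - s / n) ^ n) / s\<close> over
  \<open>[0,n]\<close>, by the geometric sum, and \<open>Ein n\<close> is that of
  \<open>(1 - exp (- s)) / s\<close>. The two integrands differ by at most
  \<open>s * exp (- s) / n\<close>, whose integral is at most \<open>1 / n\<close>.\<close>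

lemma norm_Ein_minus_harm:
  assumes "n > 0"
  shows "norm (Ein (of_nat n) - of_real (harm n)) \<le> 1 / n"
proof -
  \<comment> \<open>A primitive of the difference of the two integrands: the finite sum is
    \<open>harm n\<close> at \<open>s = 0\<close> and \<open>0\<close> at \<open>s = n\<close>. The
    function \<open>\<psi>\<close> below is a primitive of the majorant.\<close>
  define \<phi> where "\<phi> s = Ein (of_real s) + of_real (\<Sum>k<n. (1 - s / n) ^ Suc k / Suc k)" for s
  define \<psi> where "\<psi> s = - ((s + 1) * exp (- s) / n)" for s
  define \<phi>' where "\<phi>' s = Ein' (of_real s) - of_real ((\<Sum>k<n. (1 - s / n) ^ k) / n)" for s
  have d\<phi>: "(\<phi> has_vector_derivative \<phi>' s) (at s within S)" for s S
  proof -
    have 1: "((\<lambda>s. Ein (of_real s)) has_vector_derivative Ein' (of_real s)) (at s within S)"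
      by (rule has_vector_derivative_real_field[OF Ein_has_field_derivative])
    have "((\<lambda>s. \<Sum>k<n. (1 - s / n) ^ Suc k / Suc k) has_real_derivative
        (\<Sum>k<n. - ((1 - s / n) ^ k / n))) (at s within S)"
    proof (rule DERIV_sum)
      fix k
      have "((\<lambda>s. 1 - s / n) has_real_derivative - (1 / n)) (at s within S)"
        using assms by (auto intro!: derivative_eq_intros)
      note D = DERIV_cdivide[OF DERIV_power_Suc[OF this], of k "real (Suc k)"]
      have "(1 + of_nat k) * (- (1 / n) * (1 - s / n) ^ k) / real (Suc k) = - ((1 - s / n) ^ k / n)"
        using assms by (simp add: divide_simps)
      with D show "((\<lambda>s. (1 - s / n) ^ Suc k / Suc k) has_real_derivative - ((1 - s / n) ^ k / n)) (at s within S)"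
        by (simp only:)
    qed
    also have "(\<Sum>k<n. - ((1 - s / n) ^ k / n)) = - ((\<Sum>k<n. (1 - s / n) ^ k) / n)"
      by (simp add: sum_divide_distrib sum_negf)
    finally have "((\<lambda>s. complex_of_real (\<Sum>k<n. (1 - s / n) ^ Suc k / Suc k)) has_vector_derivative
        of_real (- ((\<Sum>k<n. (1 - s / n) ^ k) / n))) (at s within S)"
      by (intro has_vector_derivative_of_real) (simp add: has_real_derivative_iff_has_vector_derivative)
    from has_vector_derivative_add[OF 1 this] show ?thesis
      by (simp add: \<phi>_def[abs_def] \<phi>'_def)
  qed
  have d\<psi>: "(\<psi> has_vector_derivative (s * exp (- s) / n)) (at s within S)" for s S
    unfolding has_real_derivative_iff_has_vector_derivative[symmetric] \<psi>_def
    using assms by (auto intro!: derivative_eq_intros simp: field_simps)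
  have bound: "norm (\<phi>' s) \<le> s * exp (- s) / n" if "0 < s" "s < n" for s :: real
  proof -
    have "(\<Sum>k<n. (1 - s / n) ^ k) = (1 - (1 - s / n) ^ n) / (s / n)"
      using that by (subst sum_gp_strict) (auto simp: field_simps)
    then have "(\<Sum>k<n. (1 - s / n) ^ k) / n = (1 - (1 - s / n) ^ n) / s"
      using that assms by (simp add: field_simps)
    moreover have "Ein' (of_real s) = of_real ((1 - exp (- s)) / s)"
      using mult_Ein'[of "of_real s"] that by (simp add: field_simps flip: exp_of_real)
    ultimately have "\<phi>' s = of_real (((1 - s / n) ^ n - exp (- s)) / s)"
      unfolding \<phi>'_def by (simp add: diff_divide_distrib flip: of_real_diff)
    then have "norm (\<phi>' s) = \<bar>((1 - s / n) ^ n - exp (- s)) / s\<bar>"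
      by (simp only: norm_of_real)
    also have "\<dots> = (exp (- s) - (1 - s / n) ^ n) / s"
      using exp_minus_power_bounds(1)[of s n] that assms by (simp add: abs_if field_simps)
    also have "\<dots> \<le> (s\<^sup>2 * exp (- s) / n) / s"
      using exp_minus_power_bounds(2)[of s n] that assms by (intro divide_right_mono) auto
    also have "\<dots> = s * exp (- s) / n"
      using that by (simp add: power2_eq_square)
    finally show ?thesis .
  qed
  have "norm (\<phi> n - \<phi> 0) \<le> \<psi> n - \<psi> 0"
    by (rule differentiable_bound_general[where f' = \<phi>' and \<phi>' = "\<lambda>s. s * exp (- s) / n"])
       (use assms bound d\<phi> d\<psi> in \<open>auto intro!: continuous_on_vector_derivative\<close>)
  also have "\<psi> n - \<psi> 0 \<le> 1 / n"
    by (simp add: \<psi>_def)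
  also have "\<phi> n - \<phi> 0 = Ein (of_nat n) - of_real (harm n)"
    using assms by (simp add: \<phi>_def harm_def sum.atLeast1_atMost_eq inverse_eq_divide zero_power)
  finally show ?thesis by simp
qed

lemma Ein_minus_ln_LIMSEQ: "(\<lambda>n. Ein (of_nat n) - of_real (ln (of_nat n))) \<longlonglongrightarrow> euler_mascheroni"
proof -
  have "(\<lambda>n. Ein (of_nat n) - of_real (harm n)) \<longlonglongrightarrow> 0"
    by (rule Lim_null_comparison[OF _ lim_1_over_n])
       (use norm_Ein_minus_harm in \<open>auto simp: eventually_at_top_linorder intro!: exI[of _ 1]\<close>)
  from tendsto_add[OF this euler_mascheroni_LIMSEQ_of_real[where ?'a = complex]]
  show ?thesis by simp
qed

section \<open>\<Gamma>(0,z) on the negative imaginary axis\<close>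

text \<open>A primitive of \<open>- exp (- z) / z\<close> on the slit plane, which will turn out to
  be \<open>Gamma0 z + euler_mascheroni\<close> on the negative imaginary axis.\<close>

definition Ein_minus_Ln :: "complex \<Rightarrow> complex" where
  "Ein_minus_Ln z = Ein z - Ln z"

lemma Ein_minus_Ln_has_field_derivative:
  assumes "z \<notin> \<real>\<^sub>\<le>\<^sub>0"
  shows "(Ein_minus_Ln has_field_derivative - exp (- z) / z) (at z within S)"
proof -
  have "z \<noteq> 0" using assms by auto
  then have "Ein' z - inverse z = - exp (- z) / z"
    using arg_cong[OF mult_Ein'[of z], of "\<lambda>u. u / z"] by (simp add: diff_divide_distrib inverse_eq_divide)
  moreover have "(Ein_minus_Ln has_field_derivative Ein' z - inverse z) (at z within S)"
    unfolding Ein_minus_Ln_def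
    by (intro DERIV_diff Ein_has_field_derivative has_field_derivative_at_within[OF has_field_derivative_Ln] assms)
  ultimately show ?thesis by simp
qed

text \<open>On the ray \<open>z + s\<close> the modulus is at least \<open>y\<close>, so
  \<open>exp (- s) / y\<close> dominates the integrand and gives the bound. The value comes from the
  primitive on \<open>[0,N]\<close> as \<open>N\<close> tends to infinity; the constant is the limit
  of \<open>Ein_minus_Ln\<close> along the ray.\<close>

lemma Gamma0_imag_bound_and_value:
  assumes "y > 0"
  defines "z \<equiv> - \<i> * complex_of_real y"
  shows "norm (Gamma0 z) \<le> 1 / y" and "Gamma0 z = Ein_minus_Ln z - euler_mascheroni"
proof -
  define g where "g s = exp (- (z + of_real s)) / (z + of_real s)" for s :: real
  define h where "h s = exp (- s) / y" for s :: real
  have slit: "z + of_real s \<notin> \<real>\<^sub>\<le>\<^sub>0" for s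
    using assms by (auto simp: complex_nonpos_Reals_iff)
  have norm_ge: "y \<le> norm (z + of_real s)" for s
    using abs_Im_le_cmod[of "z + of_real s"] assms by simp
  have gh: "norm (g s) \<le> h s" for s
    using norm_ge[of s] assms(1) unfolding g_def h_def norm_divide
    by (intro frac_le) (auto simp: z_def)
  have h: "(h has_integral 1 / y) {0..}"
    using has_integral_divide[OF has_integral_exp_minus_to_infinity[of 1 0], of y]
    by (simp add: h_def[abs_def])
  have gN: "(g has_integral Ein_minus_Ln z - Ein_minus_Ln (z + of_real N)) {0..N}" if "N \<ge> 0" for N
  proof -
    have "((\<lambda>s. - Ein_minus_Ln (z + of_real s)) has_vector_derivative g s) (at s within {0..N})" for s
    proof -
      have "((\<lambda>s. z + of_real s) has_vector_derivative 1) (at s within {0..N})"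
        by (auto intro!: derivative_eq_intros)
      from field_vector_diff_chain_within[OF this Ein_minus_Ln_has_field_derivative[OF slit]]
      show ?thesis by (auto simp: o_def g_def dest: has_vector_derivative_minus)
    qed
    from fundamental_theorem_of_calculus[OF that this] show ?thesis by simp
  qed
  \<comment> \<open>Truncations extended by zero, so that dominated convergence on
    \<open>{0..}\<close> applies.\<close>
  define G where "G k s = (if s \<in> {0..real k} then g s else 0)" for k s
  have G: "(G k has_integral Ein_minus_Ln z - Ein_minus_Ln (z + of_nat k)) {0..}" for k
    unfolding G_def using gN[of "real k"] by (subst has_integral_restrict) auto
  have dom: "g integrable_on {0..}" "(\<lambda>k. integral {0..} (G k)) \<longlonglongrightarrow> integral {0..} g"
  proof (rule_tac [!] dominated_convergence[where h = h])
    fix s :: real assume s: "s \<in> {0..}"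
    show "(\<lambda>k. G k s) \<longlonglongrightarrow> g s"
    proof (rule tendsto_eventually)
      obtain k0 :: nat where "s \<le> real k0" using real_arch_simple by blast
      then show "\<forall>\<^sub>F k in sequentially. G k s = g s"
        using s by (auto simp: G_def eventually_at_top_linorder intro!: exI[of _ k0])
    qed
    then show "(\<lambda>k. G k s) \<longlonglongrightarrow> g s" .
  next
    show "norm (G k s) \<le> h s" for k s
      using gh[of s] by (auto simp: G_def h_def assms less_imp_le)
    then show "norm (G k s) \<le> h s" for k s .
  qed (use G h in \<open>auto simp: integrable_on_def\<close>)
  have Gamma0: "Gamma0 z = integral {0..} g"
    by (simp add: Gamma0_def g_def[abs_def])
  have "norm (integral {0..} g) \<le> integral {0..} h"
    using dom(1) h gh by (intro integral_norm_bound_integral) (auto simp: integrable_on_def)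
  also have "integral {0..} h = 1 / y"
    using h by (rule integral_unique)
  finally show "norm (Gamma0 z) \<le> 1 / y" by (simp add: Gamma0)

  \<comment> \<open>For \<open>Re u \<ge> k\<close> the derivative is at most \<open>1 / k\<close>
    in modulus. The limit along the ray therefore equals the one along the positive integers, which
    is known to be Euler's constant.\<close>
  have "norm (Ein_minus_Ln (z + of_nat k) - Ein_minus_Ln (of_nat k)) \<le> y / real k" if "k > 0" for k
  proof -
    let ?S = "{u. real k \<le> Re u}"
    have "norm (Ein_minus_Ln (z + of_nat k) - Ein_minus_Ln (of_nat k)) \<le> 1 / real k * norm (z + of_nat k - of_nat k)"
    proof (rule field_differentiable_bound[where S = ?S])
      show "convex ?S"
        by (simp add: convex_halfspace_Re_ge)
      fix u assume u: "u \<in> ?S"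
      with that have "u \<notin> \<real>\<^sub>\<le>\<^sub>0" by (auto simp: complex_nonpos_Reals_iff)
      then show "(Ein_minus_Ln has_field_derivative - exp (- u) / u) (at u within ?S)"
        by (rule Ein_minus_Ln_has_field_derivative)
      have "real k \<le> norm u" using u complex_Re_le_cmod[of u] by auto
      with u that show "norm (- exp (- u) / u) \<le> 1 / real k"
        unfolding norm_divide by (intro frac_le) auto
    qed (auto simp: z_def)
    also have "\<dots> = y / real k"
      using assms by (simp add: norm_mult)
    finally show ?thesis .
  qed
  then have "(\<lambda>k. Ein_minus_Ln (z + of_nat k) - Ein_minus_Ln (of_nat k)) \<longlonglongrightarrow> 0"
    by (intro Lim_null_comparison[OF _ lim_const_over_n[of y]])
       (auto simp: eventually_at_top_linorder intro!: exI[of _ 1])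
  moreover have "(\<lambda>k. Ein_minus_Ln (of_nat k)) \<longlonglongrightarrow> euler_mascheroni"
  proof (rule Lim_transform_eventually[OF Ein_minus_ln_LIMSEQ])
    show "\<forall>\<^sub>F k in sequentially. Ein (of_nat k) - of_real (ln (of_nat k)) = Ein_minus_Ln (of_nat k)"
      using eventually_gt_at_top[of 0] by eventually_elim (simp add: Ein_minus_Ln_def Ln_of_nat)
  qed
  ultimately have "(\<lambda>k. Ein_minus_Ln (z + of_nat k)) \<longlonglongrightarrow> euler_mascheroni"
    using tendsto_add by fastforce
  then have "(\<lambda>k. Ein_minus_Ln z - Ein_minus_Ln (z + of_nat k)) \<longlonglongrightarrow> Ein_minus_Ln z - euler_mascheroni"
    by (intro tendsto_intros)
  moreover have "integral {0..} (G k) = Ein_minus_Ln z - Ein_minus_Ln (z + of_nat k)" for k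
    using G by (rule integral_unique)
  ultimately show "Gamma0 z = Ein_minus_Ln z - euler_mascheroni"
    unfolding Gamma0 using dom(2) LIMSEQ_unique by simp
qed

section \<open>Two successive antiderivatives of the kernel\<close>

definition log_osc :: "real \<Rightarrow> real \<Rightarrow> complex" where
  "log_osc w x = of_real (ln x) * exp (\<i> * of_real w * of_real x)"

text \<open>At \<open>0\<close> the factor \<open>x\<close> forces the value \<open>0\<close>, which
  is also the limit from the right.\<close>

lemma continuous_on_x_ln_x: "continuous_on {0..} (\<lambda>x::real. x * ln x)"
  unfolding continuous_on_eq_continuous_within
proof
  fix x :: real assume "x \<in> {0..}"
  show "continuous (at x within {0..}) (\<lambda>x. x * ln x)"
  proof (cases "x = 0")
    case True
    have "((\<lambda>x::real. x * ln x) \<longlongrightarrow> 0) (at_right 0)"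
      by real_asymp
    moreover have "at (0::real) within {0..} = at_right 0"
    proof -
      have "{0..} - {0} = {0<..} - {0::real}" by auto
      then show ?thesis by (simp only: at_within_def)
    qed
    ultimately show ?thesis
      using True by (simp add: continuous_within)
  next
    case False
    then show ?thesis by (intro continuous_intros) auto
  qed
qed

lemma exp_minus_one_eq: "exp (\<i> * of_real y) - 1 = \<i> * of_real y * Ein' (- \<i> * of_real y)"
  using mult_Ein'[of "- \<i> * of_real y"] by (simp add: algebra_simps)

text \<open>The zero of \<open>exp (\<i>wx) - 1\<close> at \<open>0\<close> absorbs the logarithmic
  singularity: the function is a continuous factor times \<open>x * ln x\<close>.\<close>

lemma continuous_on_exp_minus_one_ln:
  "continuous_on {0..} (\<lambda>x. (exp (\<i> * of_real w * of_real x) - 1) * of_real (ln x) :: complex)"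
proof -
  have "continuous_on {0..} (\<lambda>x. \<i> * of_real w * Ein' (- \<i> * of_real (w * x)) * of_real (x * ln x))"
    by (intro continuous_intros continuous_on_x_ln_x)
  then show ?thesis
    using exp_minus_one_eq[of "w * x" for x] by (simp add: mult_ac)
qed

lemma Ein_imag_has_vector_derivative:
  fixes w x :: real
  assumes "x > 0"
  shows "((\<lambda>x. Ein (- \<i> * of_real w * of_real x)) has_vector_derivative
    (1 - exp (\<i> * of_real w * of_real x)) / of_real x) (at x within S)"
proof -
  have "((\<lambda>x. - \<i> * of_real w * complex_of_real x) has_vector_derivative - \<i> * of_real w) (at x within S)"
    by (auto intro!: derivative_eq_intros)
  from field_vector_diff_chain_within[OF this Ein_has_field_derivative]
  have "((\<lambda>x. Ein (- \<i> * of_real w * of_real x)) has_vector_derivative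
      - \<i> * of_real w * Ein' (- \<i> * of_real w * of_real x)) (at x within S)"
    by (simp add: o_def)
  moreover have "- \<i> * of_real w * Ein' (- \<i> * of_real w * of_real x) =
      (1 - exp (\<i> * of_real w * of_real x)) / of_real x"
    using mult_Ein'[of "- \<i> * of_real w * of_real x"] assms by (simp add: field_simps)
  ultimately show ?thesis by simp
qed

lemma exp_osc_has_vector_derivative:
  "((\<lambda>x. exp (\<i> * of_real w * of_real x)) has_vector_derivative
    \<i> * of_real w * exp (\<i> * of_real w * of_real x)) (at x within S)"
proof -
  have "((\<lambda>x. \<i> * of_real w * complex_of_real x) has_vector_derivative \<i> * of_real w) (at x within S)"
    by (auto intro!: derivative_eq_intros)
  from field_vector_diff_chain_within[OF this DERIV_exp[THEN has_field_derivative_at_within]]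
  show ?thesis by (simp add: o_def)
qed

lemma norm_exp_osc [simp]: "norm (exp (\<i> * of_real w * of_real x)) = 1"
  using norm_exp_i_times[of "w * x"] by (simp add: mult.assoc)

lemma ln_has_vector_derivative:
  assumes "x > 0"
  shows "((\<lambda>x. complex_of_real (ln x)) has_vector_derivative 1 / of_real x) (at x within S)"
proof -
  have "(ln has_real_derivative 1 / x) (at x within S)"
    using assms by (auto intro!: derivative_eq_intros)
  from has_vector_derivative_of_real[OF this, where ?'a = complex] show ?thesis by simp
qed

text \<open>Up to the factor \<open>\<i> w\<close>, this is \<open>exp (\<i>wx) ln x + \<Gamma>(0, -\<i>wx)\<close>, written so that it is
  continuous at \<open>0\<close>.\<close>
definition osc_prim1 :: "real \<Rightarrow> real \<Rightarrow> complex" where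
  "osc_prim1 w x = ((exp (\<i> * of_real w * of_real x) - 1) * of_real (ln x)
     + Ein (- \<i> * of_real w * of_real x) + (\<i> * of_real (pi / 2) - of_real (ln w) - euler_mascheroni))
     / (\<i> * of_real w)"

text \<open>The two middle terms together are \<open>x\<close> times \<Gamma>(0,-\<i>wx) for
  \<open>x > 0\<close>. Expressing this through \<open>osc_prim1\<close> and \<open>x * ln x\<close>
  makes continuity at \<open>0\<close> evident.\<close>

definition osc_prim2 :: "real \<Rightarrow> real \<Rightarrow> complex" where
  "osc_prim2 w x = (osc_prim1 w x + of_real x * (\<i> * of_real w * osc_prim1 w x)
     - of_real (x * ln x) * exp (\<i> * of_real w * of_real x)
     + exp (\<i> * of_real w * of_real x) / (\<i> * of_real w)) / (\<i> * of_real w)"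

lemma continuous_on_osc_prim1: "w > 0 \<Longrightarrow> continuous_on {0..a} (osc_prim1 w)"
  unfolding osc_prim1_def[abs_def]
  by (intro continuous_intros continuous_on_subset[OF continuous_on_exp_minus_one_ln]) auto

lemma continuous_on_osc_prim2: "w > 0 \<Longrightarrow> continuous_on {0..a} (osc_prim2 w)"
  unfolding osc_prim2_def[abs_def]
  by (intro continuous_intros continuous_on_osc_prim1 continuous_on_subset[OF continuous_on_x_ln_x]) auto

text \<open>The product rule yields an extra term \<open>(exp (\<i>wx) - 1) / x\<close>, which the
  derivative of \<open>Ein\<close> cancels.\<close>

lemma osc_prim1_has_vector_derivative:
  assumes "w > 0" "x > 0"
  shows "(osc_prim1 w has_vector_derivative log_osc w x) (at x within S)"
  unfolding osc_prim1_def[abs_def] log_osc_def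
  apply (rule has_vector_derivative_eq_rhs)
  apply (rule has_vector_derivative_divide has_vector_derivative_add has_vector_derivative_mult
      has_vector_derivative_const has_vector_derivative_diff
      ln_has_vector_derivative exp_osc_has_vector_derivative Ein_imag_has_vector_derivative assms)+
  using assms by (simp add: field_simps)

text \<open>The derivative of \<open>x\<close> times \<Gamma>(0,-\<i>wx) is \<Gamma>(0,-\<i>wx)
  minus \<open>exp (\<i>wx)\<close>, and the last summand of \<open>osc_prim2\<close> compensates
  this exponential.\<close>

lemma osc_prim2_has_vector_derivative:
  assumes "w > 0" "x > 0"
  shows "(osc_prim2 w has_vector_derivative osc_prim1 w x) (at x within S)"
  unfolding osc_prim2_def[abs_def] of_real_mult
  apply (rule has_vector_derivative_eq_rhs)
  apply (rule has_vector_derivative_divide has_vector_derivative_add has_vector_derivative_mult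
      has_vector_derivative_const has_vector_derivative_diff has_vector_derivative_of_real[OF DERIV_ident]
      ln_has_vector_derivative exp_osc_has_vector_derivative osc_prim1_has_vector_derivative assms)+
  using assms by (simp add: field_simps log_osc_def)

text \<open>The argument of \<open>- \<i> * y\<close> is \<open>- pi / 2\<close>; with
  \<open>y = w * x\<close> this explains the additive constant in \<open>osc_prim1\<close>.\<close>

lemma Gamma0_imag:
  assumes "y > 0"
  shows "Gamma0 (- \<i> * of_real y) = Ein (- \<i> * of_real y) - of_real (ln y) + \<i> * of_real (pi / 2) - euler_mascheroni"
proof -
  have "Ln (- \<i> * of_real y) = of_real (ln y) - \<i> * of_real (pi / 2)"
    using assms Ln_times_of_real[of y "- \<i>"] by (simp add: mult.commute Ln_of_real)
  then show ?thesis
    using Gamma0_imag_bound_and_value(2)[OF assms] by (simp add: Ein_minus_Ln_def)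
qed

lemma osc_prim1_eq_Gamma0:
  assumes "w > 0" "x > 0"
  shows "\<i> * of_real w * osc_prim1 w x =
    exp (\<i> * of_real w * of_real x) * of_real (ln x) + Gamma0 (- \<i> * of_real (w * x))"
proof -
  have "\<i> * of_real w * osc_prim1 w x = (exp (\<i> * of_real w * of_real x) - 1) * of_real (ln x)
     + Ein (- \<i> * of_real w * of_real x) + (\<i> * of_real (pi / 2) - of_real (ln w) - euler_mascheroni)"
    unfolding osc_prim1_def using assms by simp
  then show ?thesis
    using assms unfolding Gamma0_imag[OF mult_pos_pos[OF assms]]
    by (simp add: ln_mult algebra_simps)
qed

section \<open>Bounds for the antiderivatives, uniform in the frequency\<close>

lemma mult_abs_ln_le_one:
  assumes "0 < y" "y \<le> (1::real)"
  shows "y * \<bar>ln y\<bar> \<le> 1"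
proof -
  have "- ln y \<le> 1 / y - 1"
    using ln_le_minus_one[of "1 / y"] assms by (simp add: ln_div)
  then have "y * - ln y \<le> y * (1 / y - 1)"
    using assms by (intro mult_left_mono) auto
  then show ?thesis
    using assms by (simp add: algebra_simps abs_if)
qed

text \<open>The range is split at \<open>w * x = 1\<close>. Below it the form with
  \<open>Ein\<close> is used, where the factor \<open>w * x\<close> tames the logarithm; above it
  the form with \<open>Gamma0\<close>, whose modulus is at most \<open>1\<close> there. The constant
  is chosen before \<open>w\<close> and \<open>x\<close>.\<close>

lemma osc_prim1_bound:
  obtains C where "C \<ge> 1"
    "\<And>w x. w > 0 \<Longrightarrow> 0 \<le> x \<Longrightarrow> x \<le> a \<Longrightarrow> norm (osc_prim1 w x) \<le> C * (1 + \<bar>ln w\<bar>) / w"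
proof -
  have "bounded (Ein ` cball 0 1)"
    by (intro compact_imp_bounded compact_continuous_image continuous_intros) auto
  then obtain M where "\<forall>y\<in>Ein ` cball 0 1. norm y \<le> M"
    unfolding bounded_iff by blast
  then have M: "norm (Ein z) \<le> M" if "norm z \<le> 1" for z
    using that by simp
  then have "M \<ge> 0" by (metis norm_ge_zero norm_zero order_trans zero_le_one)
  define e :: complex where "e = \<i> * of_real (pi / 2) - euler_mascheroni"
  \<comment> \<open>The summand \<open>2\<close> lets \<open>C * (1 + \<bar>ln w\<bar>)\<close>
    absorb two copies of \<open>\<bar>ln w\<bar>\<close>: one from
    \<open>ln x = ln (w * x) - ln w\<close>, one from the constant in
    \<open>osc_prim1\<close>.\<close>
  define C where "C = 2 + M + norm e + \<bar>ln a\<bar>"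
  have "C \<ge> 1" using \<open>M \<ge> 0\<close> by (simp add: C_def)
  moreover have "norm (osc_prim1 w x) \<le> C * (1 + \<bar>ln w\<bar>) / w" if wx: "w > 0" "0 \<le> x" "x \<le> a" for w x
  proof -
    have C_ge: "u \<le> C * (1 + \<bar>ln w\<bar>)" if "u \<le> C + 2 * \<bar>ln w\<bar>" for u
    proof -
      have "2 * \<bar>ln w\<bar> \<le> C * \<bar>ln w\<bar>"
        using \<open>M \<ge> 0\<close> by (intro mult_right_mono) (auto simp: C_def)
      with that show ?thesis by (simp add: algebra_simps)
    qed
    have iwprim: "\<i> * of_real w * osc_prim1 w x = (exp (\<i> * of_real w * of_real x) - 1) * of_real (ln x)
        + Ein (- \<i> * of_real w * of_real x) - of_real (ln w) + e"
      unfolding osc_prim1_def e_def using wx by simp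
    have "norm (\<i> * of_real w * osc_prim1 w x) \<le> C * (1 + \<bar>ln w\<bar>)"
    proof (cases "w * x \<le> 1")
      case True
      have "norm ((exp (\<i> * of_real w * of_real x) - 1) * of_real (ln x)) \<le> 1 + \<bar>ln w\<bar>"
      proof (cases "x = 0")
        case False
        then have "x > 0" using wx by simp
        have "norm (exp (\<i> * of_real (w * x)) - 1) \<le> w * x"
          using dist_exp_i_1[of "w * x"] abs_sin_x_le_abs_x[of "w * x / 2"] wx
          by (simp add: dist_norm abs_mult)
        then have "norm (exp (\<i> * of_real w * of_real x) - 1) \<le> w * x"
          by (simp only: of_real_mult mult.assoc)
        then have "norm ((exp (\<i> * of_real w * of_real x) - 1) * of_real (ln x)) \<le> w * x * \<bar>ln x\<bar>"
          unfolding norm_mult norm_of_real by (rule mult_right_mono) simp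
        also have "\<dots> \<le> w * x * (\<bar>ln (w * x)\<bar> + \<bar>ln w\<bar>)"
          using wx \<open>x > 0\<close> by (intro mult_left_mono) (auto simp: ln_mult)
        also have "\<dots> \<le> 1 + 1 * \<bar>ln w\<bar>"
          unfolding distrib_left using True wx \<open>x > 0\<close>
          by (intro add_mono mult_right_mono mult_abs_ln_le_one) auto
        finally show ?thesis by simp
      qed auto
      moreover have "norm (Ein (- \<i> * of_real w * of_real x)) \<le> M"
        using True wx by (intro M) (simp add: norm_mult)
      ultimately have "norm (\<i> * of_real w * osc_prim1 w x) \<le> (1 + \<bar>ln w\<bar>) + M + \<bar>ln w\<bar> + norm e"
        unfolding iwprim
        by (intro order_trans[OF norm_triangle_ineq] order_trans[OF norm_triangle_ineq4] add_mono) auto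
      then show ?thesis by (intro C_ge) (simp add: C_def)
    next
      case False
      then have "x > 0" using wx by (cases "x = 0") auto
      have "0 \<le> ln (w * x)"
        using False by (intro ln_ge_zero) simp
      moreover have "ln x \<le> ln a" "ln (w * x) = ln w + ln x"
        using wx \<open>x > 0\<close> by (auto simp: ln_mult)
      \<comment> \<open>Here \<open>w * x > 1\<close> bounds \<open>ln x\<close> below by
        \<open>- ln w\<close>, and \<open>x \<le> a\<close> bounds it above.\<close>
      ultimately have "\<bar>ln x\<bar> \<le> \<bar>ln a\<bar> + \<bar>ln w\<bar>"
        by linarith
      moreover have "norm (Gamma0 (- \<i> * of_real (w * x))) \<le> 1"
        using False wx \<open>x > 0\<close> by (intro order_trans[OF Gamma0_imag_bound_and_value(1)]) auto
      ultimately have "norm (\<i> * of_real w * osc_prim1 w x) \<le> (\<bar>ln a\<bar> + \<bar>ln w\<bar>) + 1"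
        unfolding osc_prim1_eq_Gamma0[OF wx(1) \<open>x > 0\<close>]
        by (intro order_trans[OF norm_triangle_ineq] add_mono) (auto simp: norm_mult)
      then show ?thesis
        using \<open>M \<ge> 0\<close> norm_ge_zero[of e]
        by (intro C_ge) (unfold C_def, linarith)
    qed
    then show ?thesis
      using wx by (simp add: norm_mult field_simps)
  qed
  ultimately show thesis using that by blast
qed

text \<open>Since \<Gamma>(0,-\<i>wx) has modulus at most \<open>1 / (w * x)\<close>, its product
  with \<open>x\<close> is at most \<open>1 / w\<close>, as is the exponential term. The outer
  division by \<open>\<i> * w\<close> supplies the second power of \<open>w\<close>.\<close>

lemma osc_prim2_bound:
  obtains C where "C \<ge> 1"
    "\<And>w x. w > 0 \<Longrightarrow> 0 \<le> x \<Longrightarrow> x \<le> a \<Longrightarrow> norm (osc_prim2 w x) \<le> C * (1 + \<bar>ln w\<bar>) / w\<^sup>2"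
proof -
  obtain C where C: "C \<ge> 1"
    "\<And>w x. w > 0 \<Longrightarrow> 0 \<le> x \<Longrightarrow> x \<le> a \<Longrightarrow> norm (osc_prim1 w x) \<le> C * (1 + \<bar>ln w\<bar>) / w"
    using osc_prim1_bound[of a] by blast
  have "norm (osc_prim2 w x) \<le> (C + 2) * (1 + \<bar>ln w\<bar>) / w\<^sup>2" if wx: "w > 0" "0 \<le> x" "x \<le> a" for w x
  proof -
    define v where "v = osc_prim1 w x + of_real x * (\<i> * of_real w * osc_prim1 w x)
       - of_real (x * ln x) * exp (\<i> * of_real w * of_real x)"
    have "norm (v - osc_prim1 w x) \<le> 1 / w"
    proof (cases "x = 0")
      case False
      then have x: "x > 0" using wx by simp
      have "v - osc_prim1 w x = of_real x * Gamma0 (- \<i> * of_real (w * x))"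
        unfolding v_def osc_prim1_eq_Gamma0[OF wx(1) x] by (simp add: algebra_simps)
      moreover have "norm (of_real x * Gamma0 (- \<i> * of_real (w * x))) \<le> x * (1 / (w * x))"
        unfolding norm_mult using Gamma0_imag_bound_and_value(1)[of "w * x"] wx x
        by (intro mult_mono) auto
      ultimately show ?thesis using x by simp
    qed (use wx in \<open>simp add: v_def\<close>)
    then have "norm v \<le> C * (1 + \<bar>ln w\<bar>) / w + 1 / w"
      using C(2)[OF wx] norm_triangle_sub[of v "osc_prim1 w x"] by linarith
    then have "norm (v + exp (\<i> * of_real w * of_real x) / (\<i> * of_real w)) \<le> (C * (1 + \<bar>ln w\<bar>) / w + 1 / w) + 1 / w"
      using wx by (intro order_trans[OF norm_triangle_ineq] add_mono) (auto simp: norm_divide norm_mult)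
    also have "\<dots> \<le> (C + 2) * (1 + \<bar>ln w\<bar>) / w"
      using wx by (simp add: field_simps)
    finally have "norm (v + exp (\<i> * of_real w * of_real x) / (\<i> * of_real w)) / w \<le> (C + 2) * (1 + \<bar>ln w\<bar>) / w / w"
      using wx by (intro divide_right_mono) auto
    then show ?thesis
      using wx by (simp add: osc_prim2_def v_def norm_divide norm_mult power2_eq_square)
  qed
  moreover have "C + 2 \<ge> 1" using C(1) by simp
  ultimately show thesis using that by blast
qed

section \<open>Integration by parts with a singularity at the end point\<close>

text \<open>The kernel \<open>k\<close> may be singular at an end point, so \<open>K\<close> is
  differentiated in the open interval only and merely continuous up to the ends. The form with
  \<open>has_integral\<close> also provides integrability of \<open>g * k\<close>.\<close>

lemma has_integral_by_parts_interior:
  fixes g g' K k :: "real \<Rightarrow> complex"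
  assumes "a \<ge> 0"
    and g: "\<And>x. x \<in> {0..a} \<Longrightarrow> (g has_vector_derivative g' x) (at x within {0..a})"
    and g': "continuous_on {0..a} g'"
    and K: "continuous_on {0..a} K"
    and k: "\<And>x. x \<in> {0<..<a} \<Longrightarrow> (K has_vector_derivative k x) (at x)"
  shows "((\<lambda>x. g x * k x) has_integral g a * K a - g 0 * K 0 - integral {0..a} (\<lambda>x. g' x * K x)) {0..a}"
proof -
  have "continuous_on {0..a} g"
    using g by (rule continuous_on_vector_derivative)
  have "((\<lambda>x. g x * k x + g' x * K x) has_integral g a * K a - g 0 * K 0) {0..a}"
  proof (rule fundamental_theorem_of_calculus_interior)
    fix x assume x: "x \<in> {0<..<a}"
    then have "(g has_vector_derivative g' x) (at x)"
      using g[of x] at_within_Icc_at[of 0 x a] by auto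
    then show "((\<lambda>x. g x * K x) has_vector_derivative g x * k x + g' x * K x) (at x)"
      using k[OF x] by (rule has_vector_derivative_mult)
  qed (use assms \<open>continuous_on {0..a} g\<close> in \<open>auto intro!: continuous_intros\<close>)
  moreover have "((\<lambda>x. g' x * K x) has_integral integral {0..a} (\<lambda>x. g' x * K x)) {0..a}"
    by (intro integrable_integral integrable_continuous_interval continuous_intros g' K)
  ultimately have "((\<lambda>x. (g x * k x + g' x * K x) - g' x * K x) has_integral
      g a * K a - g 0 * K 0 - integral {0..a} (\<lambda>x. g' x * K x)) {0..a}"
    by (rule has_integral_diff)
  then show ?thesis by simp
qed

lemma norm_integral_by_parts_le:
  fixes g g' K k :: "real \<Rightarrow> complex"
  assumes "a \<ge> 0"
    and "\<And>x. x \<in> {0..a} \<Longrightarrow> (g has_vector_derivative g' x) (at x within {0..a})"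
    and g': "continuous_on {0..a} g'"
    and K: "continuous_on {0..a} K"
    and "\<And>x. x \<in> {0<..<a} \<Longrightarrow> (K has_vector_derivative k x) (at x)"
    and gA: "\<And>x. x \<in> {0..a} \<Longrightarrow> norm (g x) \<le> A"
    and g'B: "\<And>x. x \<in> {0..a} \<Longrightarrow> norm (g' x) \<le> B"
    and KD: "\<And>x. x \<in> {0..a} \<Longrightarrow> norm (K x) \<le> D"
  shows "norm (integral {0..a} (\<lambda>x. g x * k x)) \<le> D * (2 * A + a * B)"
proof -
  have "0 \<le> A" "0 \<le> B" "0 \<le> D"
    using gA[of 0] g'B[of 0] KD[of 0] \<open>a \<ge> 0\<close> by (auto intro: order_trans[OF norm_ge_zero])
  have "norm (integral {0..a} (\<lambda>x. g' x * K x)) \<le> (B * D) * (a - 0)"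
    by (rule integral_bound)
       (use assms \<open>0 \<le> B\<close> in \<open>auto intro!: continuous_intros mult_mono simp: norm_mult\<close>)
  moreover have "norm (g a * K a) \<le> A * D" "norm (g 0 * K 0) \<le> A * D"
    unfolding norm_mult using assms \<open>0 \<le> A\<close> by (auto intro!: mult_mono)
  ultimately have "norm (g a * K a - g 0 * K 0 - integral {0..a} (\<lambda>x. g' x * K x)) \<le> (A * D + A * D) + (B * D) * (a - 0)"
    by (intro order_trans[OF norm_triangle_ineq4] add_mono)
  also have "\<dots> = D * (2 * A + a * B)"
    by (simp add: algebra_simps)
  finally show ?thesis
    by (subst integral_unique[OF has_integral_by_parts_interior[OF assms(1-5)]])
qed

section \<open>Derivatives of the interpolation error\<close>

text \<open>Each gap between neighbouring zeros contains a zero of the derivative. The predicate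
  \<open>levin_points\<close> serves here to list distinct zeros in increasing order.\<close>

lemma Rolle_zeros:
  fixes g g' :: "real \<Rightarrow> real"
  assumes "\<And>x. x \<in> {0..a} \<Longrightarrow> (g has_real_derivative g' x) (at x within {0..a})"
    and xs: "levin_points a (Suc n) xs" and zero: "\<And>j. j < Suc n \<Longrightarrow> g (xs j) = 0"
  shows "\<exists>ys. levin_points a n ys \<and> (\<forall>j<n. g' (ys j) = 0)"
proof -
  have mono: "xs i < xs j" if "i < j" "j < Suc n" for i j
    using xs that by (auto simp: levin_points_def strict_mono_on_def)
  have rng: "0 \<le> xs j" "xs j \<le> a" if "j < Suc n" for j
    using xs that by (force simp: levin_points_def)+
  have "\<exists>y. xs j < y \<and> y < xs (Suc j) \<and> g' y = 0" if "j < n" for j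
  proof -
    have der: "(g has_real_derivative g' x) (at x within {xs j..xs (Suc j)})" if "x \<in> {xs j..xs (Suc j)}" for x
      using that \<open>j < n\<close> rng[of j] rng[of "Suc j"]
      by (intro DERIV_subset[OF assms(1)]) auto
    have "\<exists>z>xs j. z < xs (Suc j) \<and> (\<lambda>v. g' z * v) = (\<lambda>v. 0)"
    proof (rule Rolle_deriv[where f = g])
      show "continuous_on {xs j..xs (Suc j)} g"
        using der by (rule DERIV_continuous_on)
      fix x assume "xs j < x" "x < xs (Suc j)"
      then show "(g has_derivative (\<lambda>v. g' x * v)) (at x)"
        using der[of x] at_within_Icc_at[of "xs j" x "xs (Suc j)"]
        by (auto simp: has_field_derivative_def)
    qed (use that mono[of j "Suc j"] zero in auto)
    then show ?thesis by (metis mult.right_neutral)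
  qed
  then obtain ys where ys: "\<And>j. j < n \<Longrightarrow> xs j < ys j \<and> ys j < xs (Suc j) \<and> g' (ys j) = 0"
    by metis
  have "ys i < ys j" if ij: "i < j" "j < n" for i j
  proof -
    have "xs (Suc i) \<le> xs j"
      using mono[of "Suc i" j] ij by (cases "Suc i = j") auto
    then show "ys i < ys j"
      using ys[of i] ys[of j] ij by auto
  qed
  moreover have "0 \<le> ys j \<and> ys j \<le> a" if "j < n" for j
    using ys[of j] rng[of j] rng[of "Suc j"] that by auto
  ultimately have "levin_points a n ys"
    by (auto simp: levin_points_def strict_mono_on_def)
  then show ?thesis using ys by auto
qed

lemma iterated_Rolle_zeros:
  fixes G :: "nat \<Rightarrow> real \<Rightarrow> real"
  assumes "\<And>k x. k < m \<Longrightarrow> x \<in> {0..a} \<Longrightarrow> (G k has_real_derivative G (Suc k) x) (at x within {0..a})"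
    and "levin_points a (n + m) xs" "\<And>j. j < n + m \<Longrightarrow> G 0 (xs j) = 0"
  shows "\<exists>ys. levin_points a n ys \<and> (\<forall>j<n. G m (ys j) = 0)"
  using assms
proof (induction m arbitrary: n)
  case 0
  then show ?case by auto
next
  case (Suc m)
  \<comment> \<open>Reading \<open>n + Suc m\<close> as \<open>Suc n + m\<close> gives one zero of
    \<open>G m\<close> in reserve, which the last application of Rolle's theorem consumes.\<close>
  have "\<exists>ys. levin_points a (Suc n) ys \<and> (\<forall>j<Suc n. G m (ys j) = 0)"
    by (rule Suc.IH) (use Suc.prems in auto)
  then obtain ys where "levin_points a (Suc n) ys" "\<forall>j<Suc n. G m (ys j) = 0"
    by auto
  then show ?case
    using Suc.prems(1) by (intro Rolle_zeros[of a "G m"]) auto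
qed

text \<open>Lets a new zero be inserted among the nodes without determining its position.\<close>

lemma levin_points_sorted_list_of_set:
  assumes "finite Z" "Z \<subseteq> {0..a}"
  shows "levin_points a (card Z) ((!) (sorted_list_of_set Z))"
    and "j < card Z \<Longrightarrow> sorted_list_of_set Z ! j \<in> Z"
proof -
  have *: "set (sorted_list_of_set Z) = Z" "length (sorted_list_of_set Z) = card Z"
    using assms by auto
  then show **: "j < card Z \<Longrightarrow> sorted_list_of_set Z ! j \<in> Z" for j
    by (metis nth_mem)
  show "levin_points a (card Z) ((!) (sorted_list_of_set Z))"
    unfolding levin_points_def strict_mono_on_def
    using ** assms(2) * strict_sorted_list_of_set[of Z]
    by (auto simp: sorted_wrt_nth_less)
qed

text \<open>The classical error formula: subtracting a multiple of the node polynomial creates one more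
  zero at \<open>x\<close>, and the \<open>n\<close>-th derivative then vanishes somewhere.\<close>
lemma interpolation_error_real:
  fixes G :: "nat \<Rightarrow> real \<Rightarrow> real"
  assumes der: "\<And>k x. k < n \<Longrightarrow> x \<in> {0..a} \<Longrightarrow> (G k has_real_derivative G (Suc k) x) (at x within {0..a})"
    and xs: "levin_points a n xs" and zero: "\<And>j. j < n \<Longrightarrow> G 0 (xs j) = 0"
    and M: "\<And>x. x \<in> {0..a} \<Longrightarrow> \<bar>G n x\<bar> \<le> M" and x: "x \<in> {0..a}"
  shows "\<bar>G 0 x\<bar> \<le> M * a ^ n / fact n"
proof (cases "x \<in> xs ` {..<n}")
  case True
  have "0 \<le> M" "0 \<le> a" using M[OF x] x by auto
  with True zero show ?thesis by auto
next
  case False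
  define W where "W = (\<Prod>j<n. [:- xs j, 1:])"
  have W: "poly W t = (\<Prod>j<n. t - xs j)" for t
    by (simp add: W_def poly_prod)
  have "lead_coeff W = 1"
    by (simp add: W_def lead_coeff_prod)
  moreover have "degree W = n"
    by (simp add: W_def degree_prod_eq_sum_degree)
  ultimately have dW: "degree W = n" "coeff W n = 1"
    by simp_all
  have "poly W x \<noteq> 0" using False by (auto simp: W)
  define c where "c = G 0 x / poly W x"
  define H where "H k t = G k t - c * poly ((pderiv ^^ k) W) t" for k t
  define Z where "Z = insert x (xs ` {..<n})"
  have "inj_on xs {..<n}"
    using xs strict_mono_on_imp_inj_on by (auto simp: levin_points_def)
  then have card: "card Z = Suc n"
    using False by (simp add: Z_def card_image)
  have Z: "finite Z" "Z \<subseteq> {0..a}"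
    using xs x by (auto simp: Z_def levin_points_def)
  have H0: "H 0 t = 0" if "t \<in> Z" for t
    using that zero \<open>poly W x \<noteq> 0\<close> by (auto simp: Z_def H_def c_def W)
  have "\<exists>ys. levin_points a 1 ys \<and> (\<forall>j<1. H n (ys j) = 0)"
  proof (rule iterated_Rolle_zeros)
    fix k t assume "k < n" "t \<in> {0..a}"
    then show "(H k has_real_derivative H (Suc k) t) (at t within {0..a})"
      unfolding H_def by (auto intro!: derivative_eq_intros der poly_DERIV[THEN has_field_derivative_at_within])
  qed (use levin_points_sorted_list_of_set[OF Z] H0 card in auto)
  then obtain ys where "levin_points a 1 ys" "H n (ys 0) = 0"
    by auto
  then have y: "ys 0 \<in> {0..a}" "G n (ys 0) = c * poly ((pderiv ^^ n) W) (ys 0)"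
    by (auto simp: levin_points_def H_def)
  \<comment> \<open>The node polynomial is monic of degree \<open>n\<close>, so its
    \<open>n\<close>-th derivative is the constant \<open>fact n\<close>.\<close>
  have "degree ((pderiv ^^ n) W) = 0"
    by (simp add: degree_higher_pderiv dW)
  then obtain d where d: "(pderiv ^^ n) W = [:d:]"
    by (rule degree_eq_zeroE)
  have "d = coeff ((pderiv ^^ n) W) 0"
    by (simp add: d)
  also have "\<dots> = fact n"
    using dW by (simp add: coeff_higher_pderiv pochhammer_fact)
  finally have "G n (ys 0) * poly W x = G 0 x * fact n"
    using y(2) \<open>poly W x \<noteq> 0\<close> by (simp add: c_def d)
  then have "\<bar>G n (ys 0)\<bar> * \<bar>poly W x\<bar> = \<bar>G 0 x\<bar> * fact n"
    by (metis abs_mult abs_of_nonneg fact_ge_zero)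
  then have "\<bar>G 0 x\<bar> = \<bar>G n (ys 0)\<bar> * \<bar>poly W x\<bar> / fact n"
    by simp
  also have "\<bar>poly W x\<bar> \<le> (\<Prod>j<n. a)"
    unfolding W abs_prod using xs x by (intro prod_mono) (auto simp: levin_points_def subset_iff)
  then have "\<bar>G n (ys 0)\<bar> * \<bar>poly W x\<bar> / fact n \<le> M * a ^ n / fact n"
    using M[OF y(1)] by (intro divide_right_mono mult_mono) auto
  finally show ?thesis .
qed

text \<open>After \<open>m\<close> applications of Rolle's theorem the \<open>m\<close>-th
  derivative still has \<open>n - m\<close> zeros, so the error formula of order
  \<open>n - m\<close> applies to it. The rotation and the zeros depend on \<open>x\<close>, but the
  bound does not.\<close>

lemma interpolation_error_derivative:
  fixes R :: "nat \<Rightarrow> real \<Rightarrow> complex"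
  assumes der: "\<And>k x. k < n \<Longrightarrow> x \<in> {0..a} \<Longrightarrow> (R k has_vector_derivative R (Suc k) x) (at x within {0..a})"
    and xs: "levin_points a n xs" and zero: "\<And>j. j < n \<Longrightarrow> R 0 (xs j) = 0"
    and M: "\<And>x. x \<in> {0..a} \<Longrightarrow> norm (R n x) \<le> M" and x: "x \<in> {0..a}" and m: "m \<le> n"
  shows "norm (R m x) \<le> M * a ^ (n - m) / fact (n - m)"
proof -
  \<comment> \<open>If \<open>R m x = 0\<close>, then \<open>\<theta> = 0\<close>; hence only
    \<open>norm \<theta> \<le> 1\<close> is claimed.\<close>
  define \<theta> where "\<theta> = cnj (sgn (R m x))"
  have "norm \<theta> \<le> 1" by (simp add: \<theta>_def norm_sgn)
  have \<theta>: "Re (\<theta> * R m x) = norm (R m x)"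
    by (cases "R m x = 0")
       (auto simp: \<theta>_def sgn_eq complex_norm_square[symmetric] mult.commute[of "cnj _"] power2_eq_square simp flip: of_real_mult)
  define G where "G k t = Re (\<theta> * R k t)" for k t
  have G: "(G k has_real_derivative G (Suc k) t) (at t within {0..a})" if "k < n" "t \<in> {0..a}" for k t
    unfolding G_def has_real_derivative_iff_has_vector_derivative
    by (intro bounded_linear.has_vector_derivative[OF bounded_linear_Re]
        bounded_linear.has_vector_derivative[OF bounded_linear_mult_right] der that)
  obtain ys where ys: "levin_points a (n - m) ys" "\<forall>j<n - m. G m (ys j) = 0"
    using iterated_Rolle_zeros[of m a G "n - m" xs] G xs zero m by (auto simp: G_def)
  \<comment> \<open>The form \<open>m + 0\<close> exhibits the shifted family
    \<open>\<lambda>k. G (m + k)\<close> to which the real error formula is applied.\<close>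
  have "\<bar>G (m + 0) x\<bar> \<le> M * a ^ (n - m) / fact (n - m)"
  proof (rule interpolation_error_real[OF _ ys(1) _ _ x])
    fix t assume "t \<in> {0..a}"
    have "\<bar>G n t\<bar> \<le> norm \<theta> * norm (R n t)"
      unfolding G_def norm_mult[symmetric] by (rule abs_Re_le_cmod)
    also have "\<dots> \<le> 1 * M"
      using \<open>norm \<theta> \<le> 1\<close> M[OF \<open>t \<in> {0..a}\<close>] by (intro mult_mono) auto
    finally show "\<bar>G (m + (n - m)) t\<bar> \<le> M" using m by simp
  qed (use ys G in auto)
  then have "\<bar>Re (\<theta> * R m x)\<bar> \<le> M * a ^ (n - m) / fact (n - m)"
    by (simp only: G_def add_0_right)
  then show ?thesis by (simp only: \<theta> abs_norm_cancel)
qed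

section \<open>Exactness of the Levin approximation on interpolants\<close>

lemma levin_poly_eqI:
  assumes "w > 0" "n \<ge> 1" "levin_points a n xs" "levin_interpolates w n xs g p"
  shows "levin_poly w n xs g = p"
  unfolding levin_poly_def using levin_interpolates_unique[OF assms(1-3)] assms(4)
  by (rule the1_equality)

lemma levin_interpolates_levin_poly:
  assumes "w > 0" "n \<ge> 1" "levin_points a n xs"
  shows "levin_interpolates w n xs g (levin_poly w n xs g)"
  unfolding levin_poly_def by (rule theI') (rule levin_interpolates_unique[OF assms])

text \<open>The second collocation problem is solved without error, since its right-hand side is a
  polynomial of degree at most \<open>n - 2\<close>.\<close>
lemma levin_h1_exact:
  assumes "w > 0" "n \<ge> 1" "levin_points a n xs" "levin_q1 w n xs f = pCons c q"
  shows "pderiv (levin_h1 w n xs f) + smult (\<i> * of_real w) (levin_h1 w n xs f) = - q"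
proof -
  \<comment> \<open>In \<open>c + x * q\<close> the constant \<open>c\<close> is the value of
    \<open>levin_q1\<close> at \<open>0\<close>; the value of \<open>q\<close> at \<open>0\<close>
    is the derivative of \<open>levin_q1\<close> there, so the case \<open>x = 0\<close>
    agrees.\<close>
  have q2: "levin_q2 w n xs f x = poly q (of_real x)" for x
    using assms(4) by (simp add: levin_q2_def pderiv_pCons)
  have "degree (levin_q1 w n xs f) \<le> n - 1"
    using levin_interpolates_levin_poly[OF assms(1-3), of f]
    by (simp add: levin_q1_def levin_interpolates_def)
  then have "degree q \<le> n - 1"
    unfolding assms(4) by (cases "q = 0") auto
  moreover obtain h where h: "degree h \<le> degree (- q)" "pderiv h + smult (\<i> * of_real w) h = - q"
    using levin_operator_surj[of "\<i> * of_real w" "- q"] assms(1) by auto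
  moreover have "poly (pderiv h) z + \<i> * of_real w * poly h z = - poly q z" for z
    using arg_cong[OF h(2), of "\<lambda>p. poly p z"] by simp
  ultimately have "levin_interpolates w n xs (\<lambda>x. - levin_q2 w n xs f x) h"
    by (simp add: levin_interpolates_def q2)
  then have "levin_h1 w n xs f = h"
    unfolding levin_h1_def by (rule levin_poly_eqI[OF assms(1-3)])
  with h(2) show ?thesis by simp
qed

lemma poly_of_real_has_vector_derivative:
  fixes p :: "complex poly"
  shows "((\<lambda>x. poly p (of_real x)) has_vector_derivative poly (pderiv p) (of_real x)) (at x within S)"
  by (rule has_vector_derivative_real_field) (rule poly_DERIV)

text \<open>\<open>levin_antideriv\<close> is a continuous primitive of \<open>u\<close> times the
  kernel: \<open>levin_h1\<close> removes the regular remainder \<open>levin_q2\<close>, and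
  \<open>levin_h2\<close> the term with \<open>1 / x\<close> caused by subtracting the exponential
  in \<open>levin_q\<close>.\<close>

lemma levin_Q_eq_integral:
  fixes f :: "real \<Rightarrow> complex"
  assumes "w > 0" "n \<ge> 1" "levin_points a n xs" "a > 0"
  defines "u \<equiv> pderiv (levin_q1 w n xs f) + smult (\<i> * of_real w) (levin_q1 w n xs f)"
  shows "((\<lambda>x. poly u (of_real x) * log_osc w x) has_integral levin_Q a w n xs f) {0..a}"
proof -
  obtain c q where q1: "levin_q1 w n xs f = pCons c q"
    by (cases "levin_q1 w n xs f")
  define h where "h = levin_h1 w n xs f"
  have "pderiv h + smult (\<i> * of_real w) h = - q"
    unfolding h_def using assms(1-3) q1 by (rule levin_h1_exact)
  from arg_cong[OF this, of "\<lambda>p. poly p z" for z]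
  have h: "poly (pderiv h) z = - poly q z - \<i> * of_real w * poly h z" for z
    by (simp add: algebra_simps)
  have u: "poly u z = poly q z + z * poly (pderiv q) z + \<i> * of_real w * (c + z * poly q z)" for z
    by (simp add: u_def q1 pderiv_pCons algebra_simps)
  define e where "e x = exp (\<i> * of_real w * of_real x)" for x :: real
  \<comment> \<open>A form of \<open>levin_antideriv\<close> in which the logarithm occurs only in
    the continuous combinations \<open>(e x - 1) * ln x\<close> and \<open>x * ln x\<close>.\<close>
  define F where "F x = c * ((e x - 1) * of_real (ln x)) + poly q (of_real x) * e x * of_real (x * ln x)
     + poly h (of_real x) * e x + c * Ein (- \<i> * of_real w * of_real x)" for x
  have F_antideriv: "levin_antideriv w n xs f x = F x" if "x \<ge> 0" for x
  proof (cases "x = 0")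
    case True
    then show ?thesis
      by (simp add: levin_antideriv_def levin_q_def levin_h2_def F_def q1 h_def e_def)
  next
    case False
    then have "w * x > 0" using that assms(1) by simp
    from Gamma0_imag_bound_and_value(2)[OF this]
    have G: "Gamma0 (- \<i> * of_real w * of_real x) = Ein (- \<i> * of_real w * of_real x)
        - Ln (- \<i> * of_real w * of_real x) - euler_mascheroni"
      by (simp add: Ein_minus_Ln_def mult.assoc)
    have "exp (- \<i> * of_real w * of_real x) * e x = 1"
      by (simp add: e_def flip: exp_add)
    then have e1: "y * exp (- \<i> * of_real w * of_real x) * e x = y"
        "y * exp (- \<i> * of_real w * of_real x) * v * e x = y * v" for y v
      by (simp_all add: mult_ac)
    \<comment> \<open>With \<open>g\<close> for Euler's constant, \<open>L\<close> for
      \<open>Ln\<close> and \<open>N\<close> for \<open>Ein\<close>: the constant and the logarithm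
      in \<open>levin_h2\<close> cancel those of \<open>Gamma0\<close>.\<close>
    have regroup: "(Q - y * m) * v * l + H * v + (y * m * (g + (N - L - g) + L)) * v
        = Q * v * l - y * m * v * l + H * v + y * m * N * v" for Q y m v l H g N L :: complex
      by (simp add: algebra_simps)
    have "levin_antideriv w n xs f x = (c + of_real x * poly q (of_real x)) * e x * of_real (ln x)
        - c * exp (- \<i> * of_real w * of_real x) * e x * of_real (ln x)
        + poly h (of_real x) * e x
        + c * exp (- \<i> * of_real w * of_real x) * Ein (- \<i> * of_real w * of_real x) * e x"
      unfolding levin_antideriv_def levin_q_def levin_h2_def G e_def[symmetric] h_def[symmetric] q1
        if_not_P[OF False] regroup poly_pCons mult_zero_left add_0_right
      by (rule refl)
    also have "\<dots> = F x"
      unfolding e1 by (simp add: F_def algebra_simps)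
    finally show ?thesis .
  qed
  have "((\<lambda>x. poly u (of_real x) * log_osc w x) has_integral F a - F 0) {0..a}"
  proof (rule fundamental_theorem_of_calculus_interior)
    show "continuous_on {0..a} F"
    proof -
      have 1: "continuous_on {0..a} (\<lambda>x. (e x - 1) * of_real (ln x))"
        unfolding e_def by (rule continuous_on_subset[OF continuous_on_exp_minus_one_ln]) auto
      have 2: "continuous_on {0..a} (\<lambda>x. complex_of_real (x * ln x))"
        by (rule continuous_on_of_real, rule continuous_on_subset[OF continuous_on_x_ln_x]) auto
      have 3: "continuous_on {0..a} e"
        unfolding e_def[abs_def] by (intro continuous_intros)
      have 4: "continuous_on {0..a} (\<lambda>x. Ein (- \<i> * of_real w * of_real x))"
        by (intro continuous_intros)
      show ?thesis
        unfolding F_def[abs_def]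
        by (rule 1 2 3 4 continuous_on_add continuous_on_mult continuous_on_const continuous_on_poly
            continuous_on_of_real continuous_on_id)+
    qed
    fix x assume "x \<in> {0<..<a}"
    then have x: "x > 0" by simp
    have de: "(e has_vector_derivative \<i> * of_real w * e x) (at x)"
      unfolding e_def[abs_def] by (rule exp_osc_has_vector_derivative)
    \<comment> \<open>The terms \<open>c * (e x - 1) / x\<close> cancel between the first and the
      last summand, and \<open>q * e x\<close> cancels through the equation for
      \<open>h\<close>.\<close>
    show "(F has_vector_derivative poly u (of_real x) * log_osc w x) (at x)"
      unfolding F_def[abs_def] of_real_mult
      apply (rule has_vector_derivative_eq_rhs)
      apply (rule has_vector_derivative_add has_vector_derivative_mult
          has_vector_derivative_const has_vector_derivative_diff
          has_vector_derivative_of_real[OF DERIV_ident] poly_of_real_has_vector_derivative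
          ln_has_vector_derivative de Ein_imag_has_vector_derivative x)+
      using x unfolding h u log_osc_def e_def[symmetric] by (simp add: field_simps)
  qed (use assms in auto)
  then show ?thesis
    using F_antideriv[of a] F_antideriv[of 0] assms(4) by (simp add: levin_Q_def)
qed

section \<open>Reduction of the error to an integral of the residual\<close>

lemma Ck_on_has_vector_derivative:
  assumes "Ck_on n S f" "k < n" "x \<in> S"
  shows "(iter_deriv_on S k f has_vector_derivative iter_deriv_on S (Suc k) f x) (at x within S)"
proof -
  have "iter_deriv_on S k f differentiable (at x within S)"
    using assms by (auto simp: Ck_on_def differentiable_on_def)
  then show ?thesis
    by (simp add: vector_derivative_works iter_deriv_on_def)
qed

lemma max_norm_ge:
  assumes "continuous_on {0..a} g" "x \<in> {0..a}"
  shows "norm (g x) \<le> max_norm a g"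
proof -
  have "compact ((\<lambda>x. norm (g x)) ` {0..a})"
    by (intro compact_continuous_image continuous_intros assms) auto
  then show ?thesis
    unfolding max_norm_def using assms(2)
    by (intro cSUP_upper bounded_imp_bdd_above compact_imp_bounded) auto
qed

text \<open>\<open>R k\<close> is the \<open>k\<close>-th derivative of \<open>f - u\<close>.
  Because \<open>u\<close> has degree at most \<open>n - 1\<close>, \<open>R n\<close> is the
  \<open>n\<close>-th derivative of \<open>f\<close> itself, whose maximum norm thus controls all
  lower orders.\<close>

lemma levin_error_residual:
  fixes f :: "real \<Rightarrow> complex"
  assumes "w > 0" "n \<ge> 2" "levin_points a n xs" "a > 0" "Ck_on n {0..a} f"
  obtains R where
    "\<And>k x. k < n \<Longrightarrow> x \<in> {0..a} \<Longrightarrow> (R k has_vector_derivative R (Suc k) x) (at x within {0..a})"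
    "\<And>k. k \<le> n \<Longrightarrow> continuous_on {0..a} (R k)"
    "\<And>j. j < n \<Longrightarrow> R 0 (xs j) = 0"
    "\<And>k x. k \<le> n \<Longrightarrow> x \<in> {0..a} \<Longrightarrow>
       norm (R k x) \<le> max_norm a (iter_deriv_on {0..a} n f) * a ^ (n - k) / fact (n - k)"
    "levin_error a w n xs f = norm (integral {0..a} (\<lambda>x. R 0 x * log_osc w x))"
proof -
  define p where "p = levin_q1 w n xs f"
  define u where "u = pderiv p + smult (\<i> * of_real w) p"
  define R where "R k x = iter_deriv_on {0..a} k f x - poly ((pderiv ^^ k) u) (of_real x)" for k x
  have p: "levin_interpolates w n xs f p"
    using assms by (auto simp: p_def levin_q1_def intro!: levin_interpolates_levin_poly)
  have der: "(R k has_vector_derivative R (Suc k) x) (at x within {0..a})" if "k < n" "x \<in> {0..a}" for k x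
    unfolding R_def
    using has_vector_derivative_diff[OF Ck_on_has_vector_derivative[OF assms(5) that]
        poly_of_real_has_vector_derivative[of "(pderiv ^^ k) u"]] by simp
  have "degree u \<le> n - 1"
    unfolding u_def using p
    by (intro degree_add_le) (auto simp: degree_pderiv levin_interpolates_def)
  then have "(pderiv ^^ n) u = 0"
    using assms(2) by (intro poly_eqI) (simp add: coeff_higher_pderiv coeff_eq_0)
  then have Rn: "R n = iter_deriv_on {0..a} n f"
    by (simp add: R_def[abs_def])
  have contn: "continuous_on {0..a} (R n)"
    using assms(5) by (simp add: Rn Ck_on_def)
  have cont: "continuous_on {0..a} (R k)" if "k \<le> n" for k
  proof (cases "k = n")
    case False
    with that have "k < n" by simp
    then show ?thesis by (intro continuous_on_vector_derivative[of _ _ "R (Suc k)"] der)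
  qed (use contn in simp)
  have zero: "R 0 (xs j) = 0" if "j < n" for j
    using p that by (simp add: R_def u_def levin_interpolates_def iter_deriv_on_def)
  have bound: "norm (R k x) \<le> max_norm a (iter_deriv_on {0..a} n f) * a ^ (n - k) / fact (n - k)"
    if "k \<le> n" "x \<in> {0..a}" for k x
    using der assms(3) zero _ that(2,1)
    by (rule interpolation_error_derivative) (use max_norm_ge[OF contn] in \<open>auto simp: Rn\<close>)
  \<comment> \<open>The logarithm is unbounded near \<open>0\<close>, so integrability is taken from
    the integration by parts instead of continuity.\<close>
  have "(\<lambda>x. R 0 x * log_osc w x) integrable_on {0..a}"
    by (rule has_integral_integrable, rule has_integral_by_parts_interior[of a "R 0" "R 1" "osc_prim1 w"])
       (use der[of 0] cont assms continuous_on_osc_prim1 osc_prim1_has_vector_derivative in auto)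
  then have "((\<lambda>x. R 0 x * log_osc w x + poly u (of_real x) * log_osc w x) has_integral
      integral {0..a} (\<lambda>x. R 0 x * log_osc w x) + levin_Q a w n xs f) {0..a}"
    unfolding u_def p_def using assms
    by (intro has_integral_add integrable_integral levin_Q_eq_integral) auto
  moreover have "(\<lambda>x. R 0 x * log_osc w x + poly u (of_real x) * log_osc w x) =
      (\<lambda>x. f x * of_real (ln x) * exp (\<i> * of_real w * of_real x))"
    by (simp add: R_def iter_deriv_on_def log_osc_def fun_eq_iff algebra_simps)
  ultimately have "integral {0..a} (\<lambda>x. f x * of_real (ln x) * exp (\<i> * of_real w * of_real x))
      = integral {0..a} (\<lambda>x. R 0 x * log_osc w x) + levin_Q a w n xs f"
    by (simp only: integral_unique)
  then have "levin_error a w n xs f = norm (integral {0..a} (\<lambda>x. R 0 x * log_osc w x))"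
    by (simp add: levin_error_def)
  with der cont zero bound show thesis using that by blast
qed

text \<open>Two boundary contributions \<open>p\<close> and one integral contribution
  \<open>q\<close>, each at most \<open>r\<close>, account for the factor \<open>3\<close>.\<close>

lemma combine_bounds:
  fixes c l v p q r :: real
  assumes "q = r" "p \<le> r" "0 \<le> c * l / v"
  shows "c * l / v * (2 * p + q) \<le> 3 * c * l * (1 / v) * r"
  using mult_left_mono[of "2 * p + q" "3 * r" "c * l / v"] assms by simp

section \<open>The error bounds from one and from two integrations by parts\<close>

theorem theorem3p3:
  fixes a :: real
  assumes "a > 0"
  shows "(\<exists>C::real. \<forall>(n::nat) (w::real) (f::real \<Rightarrow> complex) (xs::nat \<Rightarrow> real).
            n \<ge> 2 \<longrightarrow> w > 0 \<longrightarrow> Ck_on n {0..a} f \<longrightarrow> levin_points a n xs \<longrightarrow>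
            levin_error a w n xs f
              \<le> C * (1 + \<bar>ln w\<bar>) * (1 / w) * (max_norm a (iter_deriv_on {0..a} n f) * a ^ n / fact (n - 1)))
       \<and> (\<exists>C::real. \<forall>(n::nat) (w::real) (f::real \<Rightarrow> complex) (xs::nat \<Rightarrow> real).
            n \<ge> 3 \<longrightarrow> w > 0 \<longrightarrow> Ck_on n {0..a} f \<longrightarrow> levin_points a n xs \<longrightarrow>
            xs 0 = 0 \<longrightarrow> xs (n - 1) = a \<longrightarrow>
            levin_error a w n xs f
              \<le> C * (1 + \<bar>ln w\<bar>) * (1 / w\<^sup>2) * (max_norm a (iter_deriv_on {0..a} n f) * a ^ (n - 1) / fact (n - 2)))"
proof (rule conjI)
  obtain C where C: "C \<ge> 1"
    "\<And>w x. w > 0 \<Longrightarrow> 0 \<le> x \<Longrightarrow> x \<le> a \<Longrightarrow> norm (osc_prim1 w x) \<le> C * (1 + \<bar>ln w\<bar>) / w"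
    using osc_prim1_bound[of a] by blast
  show "\<exists>C::real. \<forall>(n::nat) (w::real) (f::real \<Rightarrow> complex) (xs::nat \<Rightarrow> real).
            n \<ge> 2 \<longrightarrow> w > 0 \<longrightarrow> Ck_on n {0..a} f \<longrightarrow> levin_points a n xs \<longrightarrow>
            levin_error a w n xs f
              \<le> C * (1 + \<bar>ln w\<bar>) * (1 / w) * (max_norm a (iter_deriv_on {0..a} n f) * a ^ n / fact (n - 1))"
  proof (intro exI[of _ "3 * C"] allI impI)
    fix n :: nat and w :: real and f :: "real \<Rightarrow> complex" and xs :: "nat \<Rightarrow> real"
    assume n: "n \<ge> 2" and w: "w > 0" and f: "Ck_on n {0..a} f" and xs: "levin_points a n xs"
    define M where "M = max_norm a (iter_deriv_on {0..a} n f)"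
    obtain R where R:
      "\<And>k x. k < n \<Longrightarrow> x \<in> {0..a} \<Longrightarrow> (R k has_vector_derivative R (Suc k) x) (at x within {0..a})"
      "\<And>k. k \<le> n \<Longrightarrow> continuous_on {0..a} (R k)"
      "\<And>j. j < n \<Longrightarrow> R 0 (xs j) = 0"
      "\<And>k x. k \<le> n \<Longrightarrow> x \<in> {0..a} \<Longrightarrow> norm (R k x) \<le> M * a ^ (n - k) / fact (n - k)"
      "levin_error a w n xs f = norm (integral {0..a} (\<lambda>x. R 0 x * log_osc w x))"
    proof (unfold M_def, rule levin_error_residual[OF w n xs assms f], goal_cases)
      case (1 R)
      show ?case by (rule 1(1)[OF 1(2-6)])
    qed
    \<comment> \<open>For \<open>k = n\<close> the residual bound reduces to
      \<open>norm (R n 0) \<le> M\<close>.\<close>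
    have "0 \<le> M"
      by (rule order_trans[OF norm_ge_zero[of "R n 0"]]) (use R(4)[of n 0] assms in simp)
    have "levin_error a w n xs f \<le> C * (1 + \<bar>ln w\<bar>) / w
        * (2 * (M * a ^ n / fact n) + a * (M * a ^ (n - 1) / fact (n - 1)))"
      unfolding R(5)
    proof (rule norm_integral_by_parts_le)
      fix x assume x: "x \<in> {0..a}"
      show "(R 0 has_vector_derivative R 1 x) (at x within {0..a})"
        using R(1)[of 0 x] n x by simp
      show "norm (R 0 x) \<le> M * a ^ n / fact n" "norm (R 1 x) \<le> M * a ^ (n - 1) / fact (n - 1)"
        using R(4)[of 0 x] R(4)[of 1 x] n x by auto
      show "norm (osc_prim1 w x) \<le> C * (1 + \<bar>ln w\<bar>) / w"
        using C(2) w x by auto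
    qed (use assms n w R(2) continuous_on_osc_prim1 osc_prim1_has_vector_derivative in auto)
    also have "\<dots> \<le> 3 * C * (1 + \<bar>ln w\<bar>) * (1 / w) * (M * a ^ n / fact (n - 1))"
    proof (rule combine_bounds)
      have "a * a ^ (n - 1) = a ^ n"
        using n by (metis power_eq_if not_numeral_le_zero)
      then show "a * (M * a ^ (n - 1) / fact (n - 1)) = M * a ^ n / fact (n - 1)"
        by (metis mult.left_commute times_divide_eq_right)
      show "M * a ^ n / fact n \<le> M * a ^ n / fact (n - 1)"
        using \<open>0 \<le> M\<close> assms by (intro divide_left_mono fact_mono) auto
    qed (use C(1) w in auto)
    finally show "levin_error a w n xs f
        \<le> 3 * C * (1 + \<bar>ln w\<bar>) * (1 / w) * (max_norm a (iter_deriv_on {0..a} n f) * a ^ n / fact (n - 1))"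
      unfolding M_def .
  qed
next
  obtain C where C: "C \<ge> 1"
    "\<And>w x. w > 0 \<Longrightarrow> 0 \<le> x \<Longrightarrow> x \<le> a \<Longrightarrow> norm (osc_prim2 w x) \<le> C * (1 + \<bar>ln w\<bar>) / w\<^sup>2"
    using osc_prim2_bound[of a] by blast
  show "\<exists>C::real. \<forall>(n::nat) (w::real) (f::real \<Rightarrow> complex) (xs::nat \<Rightarrow> real).
            n \<ge> 3 \<longrightarrow> w > 0 \<longrightarrow> Ck_on n {0..a} f \<longrightarrow> levin_points a n xs \<longrightarrow>
            xs 0 = 0 \<longrightarrow> xs (n - 1) = a \<longrightarrow>
            levin_error a w n xs f
              \<le> C * (1 + \<bar>ln w\<bar>) * (1 / w\<^sup>2) * (max_norm a (iter_deriv_on {0..a} n f) * a ^ (n - 1) / fact (n - 2))"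
  proof (intro exI[of _ "3 * C"] allI impI)
    fix n :: nat and w :: real and f :: "real \<Rightarrow> complex" and xs :: "nat \<Rightarrow> real"
    assume n: "n \<ge> 3" and w: "w > 0" and f: "Ck_on n {0..a} f" and xs: "levin_points a n xs"
      and ends: "xs 0 = 0" "xs (n - 1) = a"
    define M where "M = max_norm a (iter_deriv_on {0..a} n f)"
    have "n \<ge> 2" using n by simp
    obtain R where R:
      "\<And>k x. k < n \<Longrightarrow> x \<in> {0..a} \<Longrightarrow> (R k has_vector_derivative R (Suc k) x) (at x within {0..a})"
      "\<And>k. k \<le> n \<Longrightarrow> continuous_on {0..a} (R k)"
      "\<And>j. j < n \<Longrightarrow> R 0 (xs j) = 0"
      "\<And>k x. k \<le> n \<Longrightarrow> x \<in> {0..a} \<Longrightarrow> norm (R k x) \<le> M * a ^ (n - k) / fact (n - k)"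
      "levin_error a w n xs f = norm (integral {0..a} (\<lambda>x. R 0 x * log_osc w x))"
    proof (unfold M_def, rule levin_error_residual[OF w \<open>n \<ge> 2\<close> xs assms f], goal_cases)
      case (1 R)
      show ?case by (rule 1(1)[OF 1(2-6)])
    qed
    have "0 \<le> M"
      by (rule order_trans[OF norm_ge_zero[of "R n 0"]]) (use R(4)[of n 0] assms in simp)
    \<comment> \<open>Both end points are nodes, so the first integration by parts leaves only the
      integral of \<open>R 1 * osc_prim1\<close>.\<close>
    have "R 0 0 = 0" "R 0 a = 0"
      using R(3)[of 0] R(3)[of "n - 1"] ends n by auto
    have "((\<lambda>x. R 0 x * log_osc w x) has_integral R 0 a * osc_prim1 w a - R 0 0 * osc_prim1 w 0
        - integral {0..a} (\<lambda>x. R 1 x * osc_prim1 w x)) {0..a}"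
      by (rule has_integral_by_parts_interior)
         (use assms n w R(1)[of 0] R(2) continuous_on_osc_prim1 osc_prim1_has_vector_derivative in auto)
    then have "levin_error a w n xs f = norm (integral {0..a} (\<lambda>x. R 1 x * osc_prim1 w x))"
      unfolding R(5) by (simp only: integral_unique \<open>R 0 0 = 0\<close> \<open>R 0 a = 0\<close>) simp
    also have "\<dots> \<le> C * (1 + \<bar>ln w\<bar>) / w\<^sup>2
        * (2 * (M * a ^ (n - 1) / fact (n - 1)) + a * (M * a ^ (n - 2) / fact (n - 2)))"
    \<comment> \<open>The second integration by parts keeps its boundary terms, since
      \<open>R 1\<close> may be nonzero at the ends; they are bounded through
      \<open>osc_prim2\<close>.\<close>
    proof (rule norm_integral_by_parts_le)
      fix x assume x: "x \<in> {0..a}"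
      show "(R 1 has_vector_derivative R 2 x) (at x within {0..a})"
        using R(1)[of 1 x] n x by (simp add: numeral_2_eq_2)
      show "norm (R 1 x) \<le> M * a ^ (n - 1) / fact (n - 1)" "norm (R 2 x) \<le> M * a ^ (n - 2) / fact (n - 2)"
        using R(4)[of 1 x] R(4)[of 2 x] n x by auto
      show "norm (osc_prim2 w x) \<le> C * (1 + \<bar>ln w\<bar>) / w\<^sup>2"
        using C(2) w x by auto
    qed (use assms n w R(2) continuous_on_osc_prim2 osc_prim2_has_vector_derivative in auto)
    also have "\<dots> \<le> 3 * C * (1 + \<bar>ln w\<bar>) * (1 / w\<^sup>2) * (M * a ^ (n - 1) / fact (n - 2))"
    proof (rule combine_bounds)
      have "n - 1 = Suc (n - 2)"
        using n by simp
      then have "a * a ^ (n - 2) = a ^ (n - 1)"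
        by (simp only: power_Suc)
      then show "a * (M * a ^ (n - 2) / fact (n - 2)) = M * a ^ (n - 1) / fact (n - 2)"
        by (metis mult.left_commute times_divide_eq_right)
      show "M * a ^ (n - 1) / fact (n - 1) \<le> M * a ^ (n - 1) / fact (n - 2)"
        using \<open>0 \<le> M\<close> assms by (intro divide_left_mono fact_mono) auto
    qed (use C(1) w in auto)
    finally show "levin_error a w n xs f
        \<le> 3 * C * (1 + \<bar>ln w\<bar>) * (1 / w\<^sup>2) * (max_norm a (iter_deriv_on {0..a} n f) * a ^ (n - 1) / fact (n - 2))"
      unfolding M_def .
  qed
qed

end
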